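(* Let $\mathcal A$ be a von Neumann algebra on a Hilbert space $\mathcal H$ with cyclic and separating vector $\Omega$, let $(\mathcal A_t)_{t\ge 0}$ be a filtration of $\mathcal A$ with normal conditional expectations $\mathbb E_t:\mathcal A\to\mathcal A_t$ leaving the vector state $\omega=\langle\,\cdot\,\Omega,\Omega\rangle$ invariant, let $P_t$ be the associated orthogonal projections on $\mathcal H$, let $\tau=(q_t)_{t\in[0,+\infty]}$ be a stopping time, and let $M_\tau$ be its time projection. Put $$\mathcal B_\tau=\{x\in\mathcal A: xq_t=q_tx\ \text{for each } t\ge0\},\qquad \mathcal A_\tau=\{x\in\mathcal A: xq_t=q_tx\in\mathcal A_t\ \text{for each } t\ge0\}.$$ Then $M_\tau$ restricted to $\mathcal B_\tau$ is a normal faithful conditional expectation onto $\mathcal A_\tau$ leaving $\omega$ invariant; that is, for every $x\in\mathcal B_\tau$ there is a (unique) $\mathbb E_\tau x\in\mathcal A$ with $$(\mathbb E_\tau x)\Omega=M_\tau(x\Omega),$$ and the map $\mathbb E_\tau: x\mapsto\mathbb E_\tau x$ is a normal faithful conditional expectation from $\mathcal B_\tau$ onto $\mathcal A_\tau$ such that $\omega(\mathbb E_\tau x)=\omega(x)$ for all $x\in\mathcal B_\tau$.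
   Context: Setting. $\mathcal A$ is a von Neumann algebra acting on a Hilbert space $\mathcal H$ with a cyclic and separating vector $\Omega$, and $\omega$ is the (normal faithful) vector state on $\mathcal A$ induced by $\Omega$. A filtration is an increasing family $(\mathcal A_t)_{t\ge0}$ of von Neumann subalgebras of $\mathcal A$ with $\mathcal A=\mathcal A_\infty:=(\bigcup_{t\ge0}\mathcal A_t)''$. It is assumed that for each $t\ge 0$ there is a normal conditional expectation $\mathbb E_t$ from $\mathcal A$ onto $\mathcal A_t$ with $\omega\circ\mathbb E_t=\omega$. $P_t$ is the orthogonal projection of $\mathcal H$ onto $\mathcal H_t=\overline{\mathcal A_t\Omega}$; it is determined by $P_t(x\Omega)=(\mathbb E_tx)\Omega$ for $x\in\mathcal A$, and $P_t\in\mathcal A_t'$. For $t=\infty$: $\mathbb E_\infty=\mathrm{id}$ and $P_\infty=\boldsymbol 1$. Stopping time. A stopping time $\tau=(q_t)_{t\in[0,+\infty]}$ is an increasing family of projections with $q_t\in\mathcal A_t$, $q_0=0$ and $q_\infty=\boldsymbol 1$. Time projection. For a finite partition $\theta=\{0=t_0<t_1<\dots<t_n=+\infty\}$ of $[0,+\infty]$ put $$M_{\tau(\theta)}=\sum_{i=1}^n(q_{t_i}-q_{t_{i-1}})P_{t_i}.$$ Each $M_{\tau(\theta)}$ is an orthogonal projection on $\mathcal H$, and the net $\{M_{\tau(\theta)}\}_\theta$ is decreasing as $\theta$ refines. The time projection is its strong limit $M_\tau=\lim_\theta M_{\tau(\theta)}=\bigwedge_\theta M_{\tau(\theta)}$.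 Here $\mathcal A$ is regarded as embedded in $\mathcal H$ via $x\mapsto x\Omega$, so that "$M_\tau$ restricted to $\mathcal B_\tau$ is a conditional expectation" means that $M_\tau(x\Omega)=y\Omega$ with $y\in\mathcal A$ for each $x\in\mathcal B_\tau$, and $x\mapsto y$ is a conditional expectation. *)

theory Defs
  imports "HOL-Analysis.Analysis"
begin

class scaleC =
  fixes scaleC :: "complex \<Rightarrow> 'a \<Rightarrow> 'a" (infixr "*\<^sub>C" 75)

text \<open>Complex Hilbert spaces of arbitrary dimension. The inner product is linear in its
  first argument, in accordance with the vector state \<open>\<langle>a \<Omega>, \<Omega>\<rangle>\<close>. Positive
  definiteness is contained in the last axiom.\<close>

class complex_hilbert = scaleC + real_normed_vector + complete_space +
  fixes cinner :: "'a \<Rightarrow> 'a \<Rightarrow> complex"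
  assumes scaleC_add_right: "c *\<^sub>C (x + y) = c *\<^sub>C x + c *\<^sub>C y"
    and scaleC_add_left: "(c + d) *\<^sub>C x = c *\<^sub>C x + d *\<^sub>C x"
    and scaleC_scaleC: "c *\<^sub>C d *\<^sub>C x = (c * d) *\<^sub>C x"
    and scaleC_of_real: "complex_of_real r *\<^sub>C x = r *\<^sub>R x"
    and cinner_commute: "cinner x y = cnj (cinner y x)"
    and cinner_add_left: "cinner (x + y) z = cinner x z + cinner y z"
    and cinner_scaleC_left: "cinner (c *\<^sub>C x) y = c * cinner x y"
    and cinner_self: "cinner x x = complex_of_real ((norm x)\<^sup>2)"

lemma cinner_scaleC_right:
  fixes x y :: "'h::complex_hilbert"
  shows "cinner x (c *\<^sub>C y) = cnj c * cinner x y"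
  by (metis cinner_commute cinner_scaleC_left complex_cnj_cnj complex_cnj_mult)

lemma norm_scaleC:
  fixes x :: "'h::complex_hilbert"
  shows "norm (c *\<^sub>C x) = cmod c * norm x"
proof -
  have "complex_of_real ((norm (c *\<^sub>C x))\<^sup>2) = (c * cnj c) * complex_of_real ((norm x)\<^sup>2)"
    by (simp only: cinner_self [symmetric] cinner_scaleC_left cinner_scaleC_right mult.assoc mult.left_commute)
  also have "\<dots> = complex_of_real ((cmod c * norm x)\<^sup>2)"
    by (simp only: complex_norm_square [symmetric] of_real_mult [symmetric] of_real_power [symmetric]
        power_mult_distrib)
  finally have "(norm (c *\<^sub>C x))\<^sup>2 = (cmod c * norm x)\<^sup>2"
    by (simp only: of_real_eq_iff)
  then show ?thesis
    by (simp add: power2_eq_iff_nonneg)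
qed

lemma bounded_linear_scaleC: "bounded_linear (\<lambda>x :: 'h::complex_hilbert. c *\<^sub>C x)"
proof (rule bounded_linear_intro [where K = "cmod c"])
  fix x y :: 'h and r :: real
  show "c *\<^sub>C (x + y) = c *\<^sub>C x + c *\<^sub>C y"
    by (rule scaleC_add_right)
  show "c *\<^sub>C r *\<^sub>R x = r *\<^sub>R c *\<^sub>C x"
    by (simp only: scaleC_of_real [symmetric] scaleC_scaleC mult.commute)
  show "norm (c *\<^sub>C x) \<le> norm x * cmod c"
    by (simp add: norm_scaleC mult.commute)
qed

instantiation blinfun :: (real_normed_vector, complex_hilbert) scaleC
begin

lift_definition scaleC_blinfun :: "complex \<Rightarrow> 'a \<Rightarrow>\<^sub>L 'b \<Rightarrow> 'a \<Rightarrow>\<^sub>L 'b"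
  is "\<lambda>c a x. c *\<^sub>C a x"
  by (rule bounded_linear_compose [OF bounded_linear_scaleC])

instance ..

end


text \<open>The type \<open>'h \<Rightarrow>\<^sub>L 'h\<close> consists of the bounded real-linear operators;
  \<open>B(H)\<close> is its subset of complex-linear ones.\<close>

definition bounded_ops :: "('h::complex_hilbert \<Rightarrow>\<^sub>L 'h) set" where
  "bounded_ops = {a :: 'h \<Rightarrow>\<^sub>L 'h. \<forall>c x. a (c *\<^sub>C x) = c *\<^sub>C a x}"

definition adjoint_op :: "'h::complex_hilbert \<Rightarrow>\<^sub>L 'h \<Rightarrow> 'h \<Rightarrow>\<^sub>L 'h" where
  "adjoint_op a = (THE b. b \<in> bounded_ops \<and> (\<forall>x y. cinner (a x) y = cinner x (b y)))"

definition selfadjoint_op :: "'h::complex_hilbert \<Rightarrow>\<^sub>L 'h \<Rightarrow> bool" where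
  "selfadjoint_op a \<longleftrightarrow> a \<in> bounded_ops \<and> adjoint_op a = a"

definition projection_op :: "'h::complex_hilbert \<Rightarrow>\<^sub>L 'h \<Rightarrow> bool" where
  "projection_op p \<longleftrightarrow> selfadjoint_op p \<and> p o\<^sub>L p = p"

definition positive_op :: "'h::complex_hilbert \<Rightarrow>\<^sub>L 'h \<Rightarrow> bool" where
  "positive_op a \<longleftrightarrow> a \<in> bounded_ops \<and> (\<forall>x. cinner (a x) x \<in> \<real>\<^sub>\<ge>\<^sub>0)"

definition op_le :: "'h::complex_hilbert \<Rightarrow>\<^sub>L 'h \<Rightarrow> 'h \<Rightarrow>\<^sub>L 'h \<Rightarrow> bool" where
  "op_le a b \<longleftrightarrow> positive_op (b - a)"

text \<open>The orthogonal projection onto a closed complex subspace.\<close>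

definition projection_onto :: "'h::complex_hilbert set \<Rightarrow> 'h \<Rightarrow>\<^sub>L 'h" where
  "projection_onto S = (THE p. projection_op p \<and> range (blinfun_apply p) = S)"


definition commutant :: "('h::complex_hilbert \<Rightarrow>\<^sub>L 'h) set \<Rightarrow> ('h \<Rightarrow>\<^sub>L 'h) set" where
  "commutant S = {b \<in> bounded_ops. \<forall>a\<in>S. a o\<^sub>L b = b o\<^sub>L a}"

definition von_neumann_algebra :: "('h::complex_hilbert \<Rightarrow>\<^sub>L 'h) set \<Rightarrow> bool" where
  "von_neumann_algebra A \<longleftrightarrow>
     A \<subseteq> bounded_ops \<and> (\<forall>a\<in>A. adjoint_op a \<in> A) \<and> commutant (commutant A) = A"

definition cyclic_vector :: "('h::complex_hilbert \<Rightarrow>\<^sub>L 'h) set \<Rightarrow> 'h \<Rightarrow> bool" where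
  "cyclic_vector A \<Omega> \<longleftrightarrow> closure ((\<lambda>a. blinfun_apply a \<Omega>) ` A) = UNIV"

definition separating_vector :: "('h::complex_hilbert \<Rightarrow>\<^sub>L 'h) set \<Rightarrow> 'h \<Rightarrow> bool" where
  "separating_vector A \<Omega> \<longleftrightarrow> (\<forall>a\<in>A. blinfun_apply a \<Omega> = 0 \<longrightarrow> a = 0)"

definition vector_state :: "'h::complex_hilbert \<Rightarrow> 'h \<Rightarrow>\<^sub>L 'h \<Rightarrow> complex" where
  "vector_state \<Omega> a = cinner (a \<Omega>) \<Omega>"


text \<open>Supremum in the self-adjoint part of \<open>A\<close> with respect to the operator order.\<close>

definition is_op_sup ::
  "('h::complex_hilbert \<Rightarrow>\<^sub>L 'h) set \<Rightarrow> ('h \<Rightarrow>\<^sub>L 'h) set \<Rightarrow> 'h \<Rightarrow>\<^sub>L 'h \<Rightarrow> bool" where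
  "is_op_sup A D s \<longleftrightarrow>
     s \<in> A \<and> selfadjoint_op s \<and> (\<forall>d\<in>D. op_le d s) \<and>
     (\<forall>u\<in>A. selfadjoint_op u \<and> (\<forall>d\<in>D. op_le d u) \<longrightarrow> op_le s u)"

text \<open>Normality of a positive map from \<open>A\<close> to \<open>B\<close>: suprema of bounded upward directed
  families of self-adjoint elements are preserved. Boundedness of \<open>D\<close> is implied by the
  existence of the supremum.\<close>

definition normal_map ::
  "('h::complex_hilbert \<Rightarrow>\<^sub>L 'h) set \<Rightarrow> ('h \<Rightarrow>\<^sub>L 'h) set
    \<Rightarrow> ('h \<Rightarrow>\<^sub>L 'h \<Rightarrow> 'h \<Rightarrow>\<^sub>L 'h) \<Rightarrow> bool" where
  "normal_map A B \<Phi> \<longleftrightarrow>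
     (\<forall>D s. D \<subseteq> A \<and> D \<noteq> {} \<and> (\<forall>d\<in>D. selfadjoint_op d) \<and>
        (\<forall>d\<in>D. \<forall>e\<in>D. \<exists>f\<in>D. op_le d f \<and> op_le e f) \<and> is_op_sup A D s
        \<longrightarrow> is_op_sup B (\<Phi> ` D) (\<Phi> s))"

definition faithful_map ::
  "('h::complex_hilbert \<Rightarrow>\<^sub>L 'h) set \<Rightarrow> ('h \<Rightarrow>\<^sub>L 'h \<Rightarrow> 'h \<Rightarrow>\<^sub>L 'h) \<Rightarrow> bool" where
  "faithful_map A \<Phi> \<longleftrightarrow> (\<forall>x\<in>A. \<Phi> (adjoint_op x o\<^sub>L x) = 0 \<longrightarrow> x = 0)"

text \<open>A conditional expectation from \<open>A\<close> onto \<open>B\<close>: a positive linear projection of the von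
  Neumann algebra \<open>A\<close> onto its von Neumann subalgebra \<open>B\<close> that is a \<open>B\<close>-bimodule map. Only
  the values of \<open>\<Phi>\<close> on \<open>A\<close> matter.\<close>

definition conditional_expectation ::
  "('h::complex_hilbert \<Rightarrow>\<^sub>L 'h) set \<Rightarrow> ('h \<Rightarrow>\<^sub>L 'h) set
    \<Rightarrow> ('h \<Rightarrow>\<^sub>L 'h \<Rightarrow> 'h \<Rightarrow>\<^sub>L 'h) \<Rightarrow> bool" where
  "conditional_expectation A B \<Phi> \<longleftrightarrow>
     von_neumann_algebra A \<and> von_neumann_algebra B \<and> B \<subseteq> A \<and>
     \<Phi> ` A = B \<and>
     (\<forall>x\<in>A. \<forall>y\<in>A. \<Phi> (x + y) = \<Phi> x + \<Phi> y) \<and>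
     (\<forall>c. \<forall>x\<in>A. \<Phi> (c *\<^sub>C x) = c *\<^sub>C \<Phi> x) \<and>
     (\<forall>x\<in>A. positive_op x \<longrightarrow> positive_op (\<Phi> x)) \<and>
     (\<forall>b\<in>B. \<Phi> b = b) \<and>
     (\<forall>x\<in>A. \<forall>b\<in>B. \<forall>c\<in>B. \<Phi> (b o\<^sub>L x o\<^sub>L c) = b o\<^sub>L \<Phi> x o\<^sub>L c)"


text \<open>A filtration is indexed by \<open>[0, \<infinity>]\<close>, its last member being \<open>A\<close> itself.\<close>

definition filtration ::
  "('h::complex_hilbert \<Rightarrow>\<^sub>L 'h) set \<Rightarrow> (ennreal \<Rightarrow> ('h \<Rightarrow>\<^sub>L 'h) set) \<Rightarrow> bool" where
  "filtration A F \<longleftrightarrow>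
     (\<forall>t<\<infinity>. von_neumann_algebra (F t) \<and> F t \<subseteq> A) \<and>
     (\<forall>s t. s \<le> t \<and> t < \<infinity> \<longrightarrow> F s \<subseteq> F t) \<and>
     F \<infinity> = commutant (commutant (\<Union>t\<in>{..<\<infinity>}. F t)) \<and>
     F \<infinity> = A"

definition filtration_projection ::
  "(ennreal \<Rightarrow> ('h::complex_hilbert \<Rightarrow>\<^sub>L 'h) set) \<Rightarrow> 'h \<Rightarrow> ennreal \<Rightarrow> 'h \<Rightarrow>\<^sub>L 'h" where
  "filtration_projection F \<Omega> t = projection_onto (closure ((\<lambda>a. blinfun_apply a \<Omega>) ` F t))"

definition stopping_time ::
  "(ennreal \<Rightarrow> ('h::complex_hilbert \<Rightarrow>\<^sub>L 'h) set) \<Rightarrow> (ennreal \<Rightarrow> 'h \<Rightarrow>\<^sub>L 'h) \<Rightarrow> bool" where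
  "stopping_time F q \<longleftrightarrow>
     (\<forall>t. projection_op (q t) \<and> q t \<in> F t) \<and>
     (\<forall>s t. s \<le> t \<longrightarrow> op_le (q s) (q t)) \<and>
     q 0 = 0 \<and> q \<infinity> = id_blinfun"


definition time_partitions :: "ennreal set set" where
  "time_partitions = {\<theta>. finite \<theta> \<and> 0 \<in> \<theta> \<and> \<infinity> \<in> \<theta>}"

text \<open>Convergence along this filter is convergence of nets indexed by the partitions, directed
  by refinement.\<close>

definition partitions_at_top :: "ennreal set filter" where
  "partitions_at_top =
     (INF \<theta>\<in>time_partitions. principal {\<theta>' \<in> time_partitions. \<theta> \<subseteq> \<theta>'})"

text \<open>If \<open>t\<close> is the point \<open>t\<^sub>i\<close> of \<open>\<theta>\<close> then \<open>Max {s \<in> \<theta>. s < t}\<close> is the preceding point.\<close>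

definition partition_projection ::
  "(ennreal \<Rightarrow> ('h::complex_hilbert \<Rightarrow>\<^sub>L 'h) set) \<Rightarrow> 'h \<Rightarrow> (ennreal \<Rightarrow> 'h \<Rightarrow>\<^sub>L 'h)
    \<Rightarrow> ennreal set \<Rightarrow> 'h \<Rightarrow>\<^sub>L 'h" where
  "partition_projection F \<Omega> q \<theta> =
     (\<Sum>t\<in>\<theta> - {0}. (q t - q (Max {s \<in> \<theta>. s < t})) o\<^sub>L filtration_projection F \<Omega> t)"

definition time_projection ::
  "(ennreal \<Rightarrow> ('h::complex_hilbert \<Rightarrow>\<^sub>L 'h) set) \<Rightarrow> 'h \<Rightarrow> (ennreal \<Rightarrow> 'h \<Rightarrow>\<^sub>L 'h)
    \<Rightarrow> 'h \<Rightarrow>\<^sub>L 'h" where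
  "time_projection F \<Omega> q =
     (THE M :: 'h \<Rightarrow>\<^sub>L 'h.
        \<forall>\<xi>. ((\<lambda>\<theta>. partition_projection F \<Omega> q \<theta> \<xi>) \<longlongrightarrow> M \<xi>) partitions_at_top)"

definition B_tau ::
  "('h::complex_hilbert \<Rightarrow>\<^sub>L 'h) set \<Rightarrow> (ennreal \<Rightarrow> 'h \<Rightarrow>\<^sub>L 'h) \<Rightarrow> ('h \<Rightarrow>\<^sub>L 'h) set" where
  "B_tau A q = {x \<in> A. \<forall>t<\<infinity>. x o\<^sub>L q t = q t o\<^sub>L x}"

definition A_tau ::
  "('h::complex_hilbert \<Rightarrow>\<^sub>L 'h) set \<Rightarrow> (ennreal \<Rightarrow> ('h \<Rightarrow>\<^sub>L 'h) set)
    \<Rightarrow> (ennreal \<Rightarrow> 'h \<Rightarrow>\<^sub>L 'h) \<Rightarrow> ('h \<Rightarrow>\<^sub>L 'h) set" where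
  "A_tau A F q = {x \<in> A. \<forall>t<\<infinity>. x o\<^sub>L q t = q t o\<^sub>L x \<and> q t o\<^sub>L x \<in> F t}"

end

theory Submission
  imports Defs
begin

text \<open>For \<open>x\<close> commuting with all \<open>q\<^sub>t\<close> and a partition \<open>\<theta>\<close> put \<open>\<Phi>\<^sub>\<theta>(x) = \<Sum>\<^sub>t (q\<^sub>t - q\<^sub>s) E\<^sub>t x\<close>, where \<open>t\<close> runs
  through the nonzero points of \<open>\<theta>\<close> and \<open>s\<close> precedes \<open>t\<close>.
  Then \<open>\<Phi>\<^sub>\<theta>(x) \<Omega> = M\<^sub>\<theta> (x \<Omega>)\<close>. The increments of \<open>q\<close> commute with the corresponding
  \<open>E\<^sub>t x\<close>, so \<open>\<Phi>\<^sub>\<theta>\<close> is positive and unital; in particular \<open>\<Phi>\<^sub>\<theta>(x)\<close> is bounded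
  uniformly in \<open>\<theta>\<close>. On the dense set of vectors \<open>a' \<Omega>\<close> with \<open>a'\<close> in the commutant of \<open>A\<close> one has
  \<open>\<Phi>\<^sub>\<theta>(x) a' \<Omega> = a' M\<^sub>\<theta> (x \<Omega>)\<close>, which converges because \<open>M\<^sub>\<theta>\<close> does. Hence
  \<open>\<Phi>\<^sub>\<theta>(x)\<close> converges strongly to some \<open>E\<^sub>\<tau> x \<in> A\<close>, and the algebraic properties of
  \<open>E\<^sub>\<tau>\<close> are inherited from \<open>\<Phi>\<^sub>\<theta>\<close>. Once \<open>\<theta>\<close> contains \<open>t\<close>, \<open>\<Phi>\<^sub>\<theta>(x)\<close> satisfies the
  conditions defining \<open>A\<^sub>\<tau>\<close> at time \<open>t\<close>. For normality, suprema of directed families are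
  strong limits, and \<open>(E\<^sub>\<tau> d) a' \<Omega> = a' M\<^sub>\<tau> (d \<Omega>)\<close> depends continuously on \<open>d \<Omega>\<close>.\<close>

section \<open>Hilbert spaces and adjoints\<close>

lemma cinner_add_right: "cinner x (y + z) = cinner x y + cinner x (z :: 'h::complex_hilbert)"
  by (metis cinner_add_left cinner_commute complex_cnj_add)

text \<open>The norm already satisfies the triangle inequality, so expanding the square of
  \<open>norm (x + y)\<close> bounds the real part of the inner product. Multiplying
  \<open>x\<close> by a phase then makes the inner product real and nonnegative.\<close>

lemma cinner_cauchy_schwarz: "cmod (cinner x y) \<le> norm x * norm (y :: 'h::complex_hilbert)"
proof (cases "cinner x y = 0")
  case False
  have sq: "Re (cinner x x) = (norm x)\<^sup>2" for x :: 'h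
    by (simp add: cinner_self)
  have re: "Re (cinner x y) \<le> norm x * norm y" for x y :: 'h
  proof -
    have "(norm (x + y))\<^sup>2 = (norm x)\<^sup>2 + (norm y)\<^sup>2 + 2 * Re (cinner x y)"
      using arg_cong [OF cinner_commute [of x y], of Re]
      by (simp add: cinner_add_left cinner_add_right flip: sq)
    moreover have "(norm (x + y))\<^sup>2 \<le> (norm x + norm y)\<^sup>2"
      by (simp add: norm_triangle_ineq power_mono)
    ultimately show ?thesis
      by (simp add: power2_sum)
  qed
  define c where "c = cnj (cinner x y) / of_real (cmod (cinner x y))"
  have c: "cmod c = 1"
    using False by (simp add: c_def norm_divide)
  have "cinner (c *\<^sub>C x) y = cinner x y * cnj (cinner x y) / of_real (cmod (cinner x y))"
    by (simp add: c_def cinner_scaleC_left)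
  also have "\<dots> = of_real (cmod (cinner x y))"
    using False by (simp add: complex_norm_square [symmetric] power2_eq_square)
  finally show ?thesis
    using re [of "c *\<^sub>C x" y] c by (simp add: norm_scaleC)
qed simp

text \<open>Conjugate linearity in the second argument is still real linearity. This makes the real
  bilinear calculus available: sums, differences, limits and continuity of inner products.\<close>

interpretation cinner: bounded_bilinear "cinner :: 'h::complex_hilbert \<Rightarrow> 'h \<Rightarrow> complex"
proof
  fix x y z :: 'h and r :: real
  show "cinner (x + y) z = cinner x z + cinner y z"
    by (rule cinner_add_left)
  show "cinner x (y + z) = cinner x y + cinner x z"
    by (rule cinner_add_right)
  show "cinner (r *\<^sub>R x) y = r *\<^sub>R cinner x y"
    by (simp add: cinner_scaleC_left scaleR_conv_of_real flip: scaleC_of_real)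
  show "cinner x (r *\<^sub>R y) = r *\<^sub>R cinner x y"
    by (simp add: cinner_scaleC_right scaleR_conv_of_real flip: scaleC_of_real)
  show "\<exists>K. \<forall>x y :: 'h. norm (cinner x y) \<le> norm x * norm y * K"
    using cinner_cauchy_schwarz by (intro exI [of _ 1]) auto
qed

declare cinner.zero_left [simp] cinner.zero_right [simp]

lemma norm_cinner_self: "cmod (cinner x x) = (norm (x :: 'h::complex_hilbert))\<^sup>2"
  by (simp add: cinner_self del: of_real_power)

lemma Re_cinner_self: "Re (cinner x x) = (norm (x :: 'h::complex_hilbert))\<^sup>2"
  by (simp add: cinner_self)

lemma cinner_eqI: "(\<And>z. cinner x z = cinner y z) \<Longrightarrow> x = (y :: 'h::complex_hilbert)"
  using cinner_self [of "x - y"] by (simp add: cinner.diff_left)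

lemma cinner_eqI_right: "(\<And>z. cinner z x = cinner z y) \<Longrightarrow> x = (y :: 'h::complex_hilbert)"
  using cinner_self [of "x - y"] by (simp add: cinner.diff_right)

lemma norm_add_squared:
  "(norm (x + y :: 'h::complex_hilbert))\<^sup>2 = (norm x)\<^sup>2 + (norm y)\<^sup>2 + 2 * Re (cinner x y)"
  using arg_cong [OF cinner_commute [of x y], of Re]
  by (simp add: cinner.add_left cinner.add_right flip: Re_cinner_self)

lemma parallelogram:
  "(norm (x + y :: 'h::complex_hilbert))\<^sup>2 + (norm (x - y))\<^sup>2 = 2 * (norm x)\<^sup>2 + 2 * (norm y)\<^sup>2"
  using norm_add_squared [of x y] norm_add_squared [of x "- y"] by (simp add: cinner.minus_right)

lemmas scaleC_diff_right = linear_diff [OF bounded_linear.linear [OF bounded_linear_scaleC]]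

lemma scaleC_one [simp]: "1 *\<^sub>C x = (x :: 'h::complex_hilbert)"
  using scaleC_of_real [of 1 x] by simp

lemma scaleC_zero_right [simp]: "c *\<^sub>C (0 :: 'h::complex_hilbert) = 0"
  using scaleC_diff_right [of c 0 0] by simp

lemma scaleC_minus_left: "(- c) *\<^sub>C x = - (c *\<^sub>C (x :: 'h::complex_hilbert))"
  using scaleC_add_left [of c "- c" x] scaleC_of_real [of 0 x] by (simp add: eq_neg_iff_add_eq_0 add.commute)

section \<open>Closed subspaces, orthogonal decomposition and the Riesz representation\<close>

definition csubspace :: "'h::complex_hilbert set \<Rightarrow> bool" where
  "csubspace S \<longleftrightarrow> 0 \<in> S \<and> (\<forall>x\<in>S. \<forall>y\<in>S. x + y \<in> S) \<and> (\<forall>c. \<forall>x\<in>S. c *\<^sub>C x \<in> S)"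

lemma csubspace_diff: "csubspace S \<Longrightarrow> x \<in> S \<Longrightarrow> y \<in> S \<Longrightarrow> x - y \<in> S"
  unfolding csubspace_def using scaleC_minus_left [of 1 y] by (metis add_uminus_conv_diff scaleC_one)

lemma csubspace_scaleR: "csubspace S \<Longrightarrow> x \<in> S \<Longrightarrow> r *\<^sub>R x \<in> S"
  unfolding csubspace_def by (metis scaleC_of_real)

lemma csubspace_closure:
  assumes "csubspace S"
  shows "csubspace (closure S)"
  unfolding csubspace_def
proof (intro conjI ballI allI)
  show "0 \<in> closure S"
    using assms closure_subset by (auto simp: csubspace_def)
next
  fix x y assume "x \<in> closure S" "y \<in> closure S"
  then obtain f g where "\<forall>n. f n \<in> S" "f \<longlonglongrightarrow> x" "\<forall>n. g n \<in> S" "g \<longlonglongrightarrow> y"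
    by (auto simp: closure_sequential)
  then show "x + y \<in> closure S"
    using assms unfolding closure_sequential csubspace_def
    by (intro exI [of _ "\<lambda>n. f n + g n"]) (auto intro: tendsto_add)
next
  fix x c assume "x \<in> closure S"
  then obtain f where "\<forall>n. f n \<in> S" "f \<longlonglongrightarrow> x"
    by (auto simp: closure_sequential)
  then show "c *\<^sub>C x \<in> closure S"
    using assms unfolding closure_sequential csubspace_def
    by (intro exI [of _ "\<lambda>n. c *\<^sub>C f n"]) (auto intro: bounded_linear.tendsto [OF bounded_linear_scaleC])
qed

text \<open>If \<open>a = cinner v s\<close> were nonzero, a small step from \<open>v\<close> in the
  direction of \<open>- a\<close> times \<open>s\<close> would shorten \<open>v\<close>: the gain is
  linear in the step size \<open>k\<close>, the loss only quadratic.\<close>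

lemma minimal_norm_imp_orthogonal:
  fixes v s :: "'h::complex_hilbert"
  assumes "\<And>c. norm v \<le> norm (v + c *\<^sub>C s)"
  shows "cinner v s = 0"
proof (rule ccontr)
  define a where "a = cinner v s"
  \<comment> \<open>The summand 1 makes \<open>k * (norm s)\<^sup>2\<close> strictly less than 1, so
    that the quadratic term cannot compensate the linear one.\<close>
  define k where "k = 1 / ((norm s)\<^sup>2 + 1)"
  assume "cinner v s \<noteq> 0"
  then have a: "(cmod a)\<^sup>2 > 0"
    by (simp add: a_def)
  have "(norm s)\<^sup>2 + 1 > 0"
    by (simp add: add_nonneg_pos)
  then have k: "k > 0" "k * (norm s)\<^sup>2 < 1"
    by (simp_all add: k_def)
  have "(norm v)\<^sup>2 \<le> (norm (v + (- (of_real k * a)) *\<^sub>C s))\<^sup>2"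
    by (intro power_mono assms) auto
  also have "\<dots> = (norm v)\<^sup>2 + k\<^sup>2 * (cmod a)\<^sup>2 * (norm s)\<^sup>2 - 2 * k * (cmod a)\<^sup>2"
  proof -
    have "cinner v ((- (of_real k * a)) *\<^sub>C s) = - of_real k * (a * cnj a)"
      by (simp add: cinner_scaleC_right a_def mult_ac)
    then have "Re (cinner v ((- (of_real k * a)) *\<^sub>C s)) = - k * (cmod a)\<^sup>2"
      by (simp add: complex_norm_square [symmetric])
    moreover have "(norm ((- (of_real k * a)) *\<^sub>C s))\<^sup>2 = k\<^sup>2 * (cmod a)\<^sup>2 * (norm s)\<^sup>2"
      by (simp add: norm_scaleC norm_mult power_mult_distrib)
    ultimately show ?thesis
      unfolding norm_add_squared by simp
  qed
  finally have "2 * k * (cmod a)\<^sup>2 \<le> k * (cmod a)\<^sup>2 * (k * (norm s)\<^sup>2)"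
    by (simp add: power2_eq_square algebra_simps)
  also have "\<dots> \<le> k * (cmod a)\<^sup>2 * 1"
    using k a by (intro mult_left_mono) auto
  finally show False
    using k a by simp
qed

text \<open>The point \<open>y\<close> is the best approximation of \<open>x\<close> in
  \<open>S\<close>. A minimizing sequence is Cauchy by the parallelogram law, and minimality of the
  distance at \<open>y\<close> gives orthogonality.\<close>

lemma orthogonal_decomposition:
  fixes x :: "'h::complex_hilbert"
  assumes S: "csubspace S" "closed S"
  shows "\<exists>y\<in>S. \<forall>s\<in>S. cinner (x - y) s = 0"
proof -
  define d where "d = (INF s\<in>S. norm (x - s))"
  have ne: "S \<noteq> {}"
    using S by (auto simp: csubspace_def)
  have lower: "d \<le> norm (x - s)" if "s \<in> S" for s
    unfolding d_def by (rule cINF_lower [OF _ that]) (auto intro: bdd_belowI [of _ 0])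
  have d0: "d \<ge> 0"
    unfolding d_def by (rule cINF_greatest [OF ne]) auto
  have "\<exists>s\<in>S. norm (x - s) < d + 1 / real (Suc n)" for n
    using cInf_lessD [of "(\<lambda>s. norm (x - s)) ` S" "d + 1 / real (Suc n)"] ne by (auto simp flip: d_def)
  then obtain f where f: "\<And>n. f n \<in> S" "\<And>n. norm (x - f n) < d + 1 / real (Suc n)"
    by metis
  have lim: "(\<lambda>n. (d + 1 / real (Suc n))\<^sup>2) \<longlonglongrightarrow> (d + 0)\<^sup>2"
    by (intro tendsto_intros LIMSEQ_Suc lim_1_over_n)
  have close: "(norm (f m - f n))\<^sup>2 \<le> 2 * (d + 1 / real (Suc m))\<^sup>2 + 2 * (d + 1 / real (Suc n))\<^sup>2 - 4 * d\<^sup>2" for m n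
  proof -
    \<comment> \<open>The midpoint stays in \<open>S\<close>, so its distance from \<open>x\<close>
      is at least \<open>d\<close>; the parallelogram law turns this into an upper bound for the
      distance between \<open>f m\<close> and \<open>f n\<close>.\<close>
    have "(1/2) *\<^sub>R (f m + f n) \<in> S"
      using f S by (intro csubspace_scaleR) (auto simp: csubspace_def)
    then have "d\<^sup>2 \<le> (norm (x - (1/2) *\<^sub>R (f m + f n)))\<^sup>2"
      using lower d0 by (intro power_mono) auto
    moreover have "(x - f m) + (x - f n) = 2 *\<^sub>R (x - (1/2) *\<^sub>R (f m + f n))"
      by (simp add: algebra_simps scaleR_2)
    then have "(norm ((x - f m) + (x - f n)))\<^sup>2 = 4 * (norm (x - (1/2) *\<^sub>R (f m + f n)))\<^sup>2"
      by (simp only: norm_scaleR) (simp add: power_mult_distrib)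
    moreover have "(norm (x - f n))\<^sup>2 \<le> (d + 1 / real (Suc n))\<^sup>2" for n
      using f(2) [of n] by (intro power_mono) auto
    note this [of m] this [of n]
    moreover have "(norm ((x - f m) - (x - f n)))\<^sup>2 = (norm (f m - f n))\<^sup>2"
      by (simp add: norm_minus_commute)
    ultimately show ?thesis
      using parallelogram [of "x - f m" "x - f n"] by linarith
  qed
  have "Cauchy f"
  proof (rule metric_CauchyI)
    fix e :: real assume "e > 0"
    then have "\<forall>\<^sub>F n in sequentially. (d + 1 / real (Suc n))\<^sup>2 < d\<^sup>2 + e\<^sup>2 / 4"
      using order_tendstoD(2) [OF lim] by simp
    then obtain N where N: "\<And>n. n \<ge> N \<Longrightarrow> (d + 1 / real (Suc n))\<^sup>2 < d\<^sup>2 + e\<^sup>2 / 4"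
      by (auto simp: eventually_sequentially)
    have "dist (f m) (f n) < e" if "m \<ge> N" "n \<ge> N" for m n
    proof -
      have "(norm (f m - f n))\<^sup>2 < e\<^sup>2"
        using close [of m n] N [OF that(1)] N [OF that(2)] by linarith
      then show ?thesis
        using \<open>e > 0\<close> by (simp add: dist_norm power_less_imp_less_base)
    qed
    then show "\<exists>M. \<forall>m\<ge>M. \<forall>n\<ge>M. dist (f m) (f n) < e"
      by blast
  qed
  then obtain y where y: "f \<longlonglongrightarrow> y"
    using Cauchy_convergent convergent_def by blast
  have yS: "y \<in> S"
    using closed_sequentially [OF S(2) f(1) y] .
  have "norm (x - y) \<le> d + 0"
  proof (rule LIMSEQ_le)
    show "(\<lambda>n. norm (x - f n)) \<longlonglongrightarrow> norm (x - y)"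
      by (intro tendsto_intros y)
    show "(\<lambda>n. d + 1 / real (Suc n)) \<longlonglongrightarrow> d + 0"
      by (intro tendsto_intros LIMSEQ_Suc lim_1_over_n)
  qed (use less_imp_le [OF f(2)] in blast)
  have "cinner (x - y) s = 0" if "s \<in> S" for s
  proof (rule minimal_norm_imp_orthogonal)
    fix c
    have "y - c *\<^sub>C s \<in> S"
      using S yS that by (intro csubspace_diff) (auto simp: csubspace_def)
    then show "norm (x - y) \<le> norm (x - y + c *\<^sub>C s)"
      using lower [of "y - c *\<^sub>C s"] \<open>norm (x - y) \<le> d + 0\<close> by (simp add: algebra_simps)
  qed
  then show ?thesis
    using yS by blast
qed

text \<open>Choose \<open>v\<close> nonzero and orthogonal to the kernel of \<open>f\<close>. For
  each \<open>u\<close>, subtracting the multiple \<open>f u / f v\<close> of \<open>v\<close> lands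
  in the kernel, and pairing the difference with \<open>v\<close> recovers
  \<open>f u\<close>.\<close>

lemma riesz_representation:
  fixes f :: "'h::complex_hilbert \<Rightarrow> complex"
  assumes bl: "bounded_linear f" and sc: "\<And>c x. f (c *\<^sub>C x) = c * f x"
  shows "\<exists>z. \<forall>x. f x = cinner x z"
proof (cases "\<forall>x. f x = 0")
  case True
  then show ?thesis
    by (intro exI [of _ 0]) simp
next
  case False
  interpret f: bounded_linear f by fact
  obtain x where x: "f x \<noteq> 0"
    using False by auto
  have "csubspace (f -` {0})"
    by (auto simp: csubspace_def f.add sc)
  moreover have "closed (f -` {0})"
    by (intro closed_vimage) (auto simp: linear_continuous_on bl)
  ultimately obtain y where y: "f y = 0" "\<And>s. f s = 0 \<Longrightarrow> cinner (x - y) s = 0"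
    using orthogonal_decomposition [of "f -` {0}" x] by auto
  define v where "v = x - y"
  have v: "f v = f x" "v \<noteq> 0"
    using x y by (auto simp: v_def f.diff)
  have orth: "cinner s v = 0" if "f s = 0" for s
    using y(2) [OF that] cinner_commute [of s v] by (simp add: v_def)
  have "f u = cinner u (cnj (f v / cinner v v) *\<^sub>C v)" for u
  proof -
    have "cinner (u - (f u / f v) *\<^sub>C v) v = 0"
      by (rule orth) (simp add: f.diff sc v x)
    then have "cinner u v = f u / f v * cinner v v"
      by (simp add: cinner.diff_left cinner_scaleC_left)
    then show ?thesis
      using v x by (simp add: cinner_scaleC_right cinner_self)
  qed
  then show ?thesis
    by blast
qed

section \<open>Complex-linear bounded operators and their adjoints\<close>

lemma bounded_opsD: "a \<in> bounded_ops \<Longrightarrow> a (c *\<^sub>C x) = c *\<^sub>C a x"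
  by (auto simp: bounded_ops_def)

lemma bounded_ops_add: "a \<in> bounded_ops \<Longrightarrow> b \<in> bounded_ops \<Longrightarrow> a + b \<in> bounded_ops"
  by (auto simp: bounded_ops_def blinfun.add_left scaleC_add_right)

lemma bounded_ops_diff: "a \<in> bounded_ops \<Longrightarrow> b \<in> bounded_ops \<Longrightarrow> a - b \<in> bounded_ops"
  by (auto simp: bounded_ops_def blinfun.diff_left scaleC_diff_right)

lemma bounded_ops_compose: "a \<in> bounded_ops \<Longrightarrow> b \<in> bounded_ops \<Longrightarrow> a o\<^sub>L b \<in> bounded_ops"
  by (auto simp: bounded_ops_def)

lemma bounded_ops_id: "id_blinfun \<in> bounded_ops"
  by (auto simp: bounded_ops_def)

lemma bounded_ops_zero: "0 \<in> bounded_ops"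
  by (auto simp: bounded_ops_def)

lemma bounded_ops_scaleC: "a \<in> bounded_ops \<Longrightarrow> c *\<^sub>C a \<in> bounded_ops"
  by (auto simp: bounded_ops_def scaleC_blinfun.rep_eq scaleC_scaleC mult.commute)

lemma adjoint_eqI:
  fixes a b :: "'h::complex_hilbert \<Rightarrow>\<^sub>L 'h"
  assumes "b \<in> bounded_ops" "\<And>x y. cinner (a x) y = cinner x (b y)"
  shows "adjoint_op a = b"
  unfolding adjoint_op_def
proof (rule the_equality)
  fix c :: "'h \<Rightarrow>\<^sub>L 'h"
  assume "c \<in> bounded_ops \<and> (\<forall>x y. cinner (a x) y = cinner x (c y))"
  with assms have "cinner x (c y) = cinner x (b y)" for x y
    by metis
  then show "c = b"
    by (intro blinfun_eqI cinner_eqI_right) auto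
qed (use assms in auto)

text \<open>Riesz gives \<open>b y\<close> for each fixed \<open>y\<close>. Linearity of
  \<open>b\<close> follows from uniqueness of the representing vector; boundedness follows from
  \<open>(norm (b y))\<^sup>2 = cmod (cinner (a (b y)) y)\<close> and Cauchy-Schwarz.\<close>

lemma adjoint_exists:
  assumes "a \<in> bounded_ops"
  shows "\<exists>b\<in>bounded_ops. \<forall>x y. cinner (a x) y = cinner x (b y)"
proof -
  have "\<exists>z. \<forall>x. cinner (a x) y = cinner x z" for y
    by (rule riesz_representation)
      (auto intro: bounded_linear_compose [OF cinner.bounded_linear_left] blinfun.bounded_linear_right
        simp: bounded_opsD [OF assms] cinner_scaleC_left)
  then obtain b where b: "\<And>x y. cinner (a x) y = cinner x (b y)"
    by metis
  have "norm (b y) \<le> norm y * norm a" for y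
  proof -
    have "(norm (b y))\<^sup>2 = cmod (cinner (a (b y)) y)"
      by (simp add: b norm_cinner_self)
    also have "\<dots> \<le> norm (a (b y)) * norm y"
      by (rule cinner_cauchy_schwarz)
    also have "\<dots> \<le> norm a * norm (b y) * norm y"
      by (intro mult_right_mono norm_blinfun) auto
    finally have "norm (b y) * norm (b y) \<le> norm (b y) * (norm y * norm a)"
      by (simp add: power2_eq_square mult_ac)
    then show ?thesis
      by (cases "norm (b y) = 0") (auto simp: zero_le_mult_iff)
  qed
  then have "bounded_linear b"
    by (intro bounded_linear_intro [of b "norm a"] cinner_eqI_right)
      (auto simp: cinner.add_right cinner.scaleR_right simp flip: b)
  moreover have "b (c *\<^sub>C y) = c *\<^sub>C b y" for c y
    by (rule cinner_eqI_right) (simp add: cinner_scaleC_right flip: b)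
  ultimately show ?thesis
    using b by (intro bexI [of _ "Blinfun b"]) (auto simp: bounded_ops_def bounded_linear_Blinfun_apply)
qed

lemma adjoint_op:
  assumes "a \<in> bounded_ops"
  shows adjoint_op_bounded: "adjoint_op a \<in> bounded_ops"
    and cinner_adjoint: "cinner (a x) y = cinner x (adjoint_op a y)"
    and cinner_adjoint': "cinner (adjoint_op a x) y = cinner x (a y)"
proof -
  obtain b where b: "b \<in> bounded_ops" "\<And>x y. cinner (a x) y = cinner x (b y)"
    using adjoint_exists [OF assms] by blast
  then have "adjoint_op a = b"
    by (rule adjoint_eqI)
  then show "adjoint_op a \<in> bounded_ops" "cinner (a x) y = cinner x (adjoint_op a y)"
    "cinner (adjoint_op a x) y = cinner x (a y)"
    using b by (simp_all, metis cinner_commute)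
qed

lemma adjoint_compose:
  "a \<in> bounded_ops \<Longrightarrow> b \<in> bounded_ops \<Longrightarrow> adjoint_op (a o\<^sub>L b) = adjoint_op b o\<^sub>L adjoint_op a"
  by (rule adjoint_eqI) (auto simp: cinner_adjoint intro: bounded_ops_compose adjoint_op_bounded)

lemma adjoint_add:
  "a \<in> bounded_ops \<Longrightarrow> b \<in> bounded_ops \<Longrightarrow> adjoint_op (a + b) = adjoint_op a + adjoint_op b"
  by (rule adjoint_eqI)
    (auto simp: cinner_adjoint blinfun.add_left cinner.add_left cinner.add_right
      intro: bounded_ops_add adjoint_op_bounded)

lemma norm_adjoint_le:
  assumes "a \<in> bounded_ops"
  shows "norm (adjoint_op a) \<le> norm a"
proof (rule norm_blinfun_bound)
  fix y
  have "(norm (adjoint_op a y))\<^sup>2 = cmod (cinner (a (adjoint_op a y)) y)"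
    by (simp add: cinner_adjoint [OF assms] norm_cinner_self)
  also have "\<dots> \<le> norm (a (adjoint_op a y)) * norm y"
    by (rule cinner_cauchy_schwarz)
  also have "\<dots> \<le> norm a * norm (adjoint_op a y) * norm y"
    by (intro mult_right_mono norm_blinfun) auto
  finally have "norm (adjoint_op a y) * norm (adjoint_op a y) \<le> norm (adjoint_op a y) * (norm a * norm y)"
    by (simp add: power2_eq_square mult_ac)
  then show "norm (adjoint_op a y) \<le> norm a * norm y"
    by (cases "norm (adjoint_op a y) = 0") auto
qed auto

lemma selfadjoint_opI:
  "a \<in> bounded_ops \<Longrightarrow> (\<And>x y. cinner (a x) y = cinner x (a y)) \<Longrightarrow> selfadjoint_op a"
  by (simp add: selfadjoint_op_def adjoint_eqI)

lemma selfadjoint_op_bounded: "selfadjoint_op a \<Longrightarrow> a \<in> bounded_ops"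
  by (simp add: selfadjoint_op_def)

lemma selfadjoint_opD: "selfadjoint_op a \<Longrightarrow> cinner (a x) y = cinner x (a y)"
  by (metis cinner_adjoint selfadjoint_op_def)

lemma selfadjoint_op_add: "selfadjoint_op a \<Longrightarrow> selfadjoint_op b \<Longrightarrow> selfadjoint_op (a + b)"
  by (simp add: selfadjoint_op_def adjoint_add bounded_ops_add)

lemma selfadjoint_op_diff: "selfadjoint_op a \<Longrightarrow> selfadjoint_op b \<Longrightarrow> selfadjoint_op (a - b)"
  by (rule selfadjoint_opI)
    (auto simp: selfadjoint_opD selfadjoint_op_bounded bounded_ops_diff blinfun.diff_left
      cinner.diff_left cinner.diff_right)

lemma bounded_ops_scaleR: "a \<in> bounded_ops \<Longrightarrow> r *\<^sub>R a \<in> bounded_ops"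
  using bounded_ops_scaleC [of a "of_real r"]
  by (simp add: bounded_ops_def scaleC_blinfun.rep_eq scaleC_of_real blinfun.scaleR_left)

lemma selfadjoint_op_scaleR: "selfadjoint_op a \<Longrightarrow> selfadjoint_op (r *\<^sub>R a)"
  by (rule selfadjoint_opI)
    (auto simp: selfadjoint_opD selfadjoint_op_bounded bounded_ops_scaleR blinfun.scaleR_left
      cinner.scaleR_left cinner.scaleR_right)

lemma selfadjoint_op_id: "selfadjoint_op id_blinfun"
  by (rule selfadjoint_opI) (auto simp: bounded_ops_id)

section \<open>Projections and positive operators\<close>

lemma projection_opI:
  "p \<in> bounded_ops \<Longrightarrow> (\<And>x y. cinner (p x) y = cinner x (p y)) \<Longrightarrow> (\<And>x. p (p x) = p x) \<Longrightarrow> projection_op p"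
  by (auto simp: projection_op_def intro!: selfadjoint_opI blinfun_eqI)

lemma projection_op_selfadjoint: "projection_op p \<Longrightarrow> selfadjoint_op p"
  by (simp add: projection_op_def)

lemma projection_op_idem: "projection_op p \<Longrightarrow> p (p x) = p x"
  by (metis blinfun_apply_blinfun_compose projection_op_def)

text \<open>Each projection fixes the common range pointwise, so \<open>p' p = p\<close> and
  \<open>p p' = p'\<close>; self-adjointness then identifies the two. This justifies the definite
  description in \<open>projection_onto\<close>.\<close>

lemma projection_op_eqI:
  fixes p p' :: "'h::complex_hilbert \<Rightarrow>\<^sub>L 'h"
  assumes p: "projection_op p" and p': "projection_op p'" and r: "range (blinfun_apply p) = range (blinfun_apply p')"
  shows "p = p'"
proof -
  have 1: "p (p' x) = p' x" "p' (p x) = p x" for x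
    using r p p' by (metis projection_op_idem rangeE rangeI)+
  have "cinner (p x) y = cinner (p' x) y" for x y
    using p p' by (metis 1 projection_op_selfadjoint selfadjoint_opD)
  then show ?thesis
    by (intro blinfun_eqI cinner_eqI)
qed

lemma projection_onto_exists:
  fixes S :: "'h::complex_hilbert set"
  assumes S: "csubspace S" "closed S"
  shows "\<exists>p. projection_op p \<and> range (blinfun_apply p) = S"
proof -
  obtain f where f: "\<And>x. f x \<in> S" "\<And>x s. s \<in> S \<Longrightarrow> cinner (x - f x) s = 0"
    using orthogonal_decomposition [OF S] by metis
  \<comment> \<open>The orthogonal decomposition determines its component in \<open>S\<close>.
    Linearity of \<open>f\<close> and its action as the identity on \<open>S\<close> are all read
    off from this uniqueness.\<close>
  have unique: "f x = y" if "y \<in> S" "\<And>s. s \<in> S \<Longrightarrow> cinner (x - y) s = 0" for x y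
  proof -
    have "cinner (f x - y) (f x - y) = cinner (x - y) (f x - y) - cinner (x - f x) (f x - y)"
      by (simp add: cinner.diff_left)
    also have "\<dots> = 0"
      using that f S by (simp add: csubspace_diff)
    finally show ?thesis
      by (simp add: cinner_self)
  qed
  have add: "f (x + y) = f x + f y" for x y
    using f S by (intro unique)
      (auto simp: csubspace_def add_diff_add cinner.add_left)
  have scale: "f (c *\<^sub>C x) = c *\<^sub>C f x" for c x
    using f S by (intro unique)
      (auto simp: csubspace_def cinner_scaleC_left simp flip: scaleC_diff_right)
  have le: "norm (f x) \<le> norm x * 1" for x
  proof -
    have "cinner (f x) (x - f x) = 0"
      using f cinner_commute [of "f x" "x - f x"] by simp
    then have "(norm x)\<^sup>2 = (norm (f x))\<^sup>2 + (norm (x - f x))\<^sup>2"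
      using norm_add_squared [of "f x" "x - f x"] by simp
    then have "(norm (f x))\<^sup>2 \<le> (norm x)\<^sup>2"
      by simp
    then show ?thesis
      using power2_le_imp_le by force
  qed
  have "bounded_linear f"
    using scale [of "of_real _"] by (intro bounded_linear_intro [of f 1] add le) (simp add: scaleC_of_real)
  then have app: "blinfun_apply (Blinfun f) = f"
    by (simp add: bounded_linear_Blinfun_apply)
  have fS: "f s = s" if "s \<in> S" for s
    using that by (intro unique) auto
  have "cinner (f x) y = cinner (f x) (f y)" for x y
    using f(2) [OF f(1), of y x] cinner_commute [of "f x" "y - f y"] by (simp add: cinner.diff_right)
  moreover have "cinner x (f y) = cinner (f x) (f y)" for x y
    using f(2) [OF f(1), of x y] by (simp add: cinner.diff_left)
  ultimately have "projection_op (Blinfun f)"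
    by (intro projection_opI) (auto simp: app bounded_ops_def scale fS f)
  moreover have "range f = S"
    using f fS by (metis image_subset_iff rangeI subsetI subset_antisym)
  ultimately show ?thesis
    using app by metis
qed

lemma projection_onto:
  assumes "csubspace S" "closed S"
  shows "projection_op (projection_onto S)" and "range (blinfun_apply (projection_onto S)) = S"
proof -
  obtain p where p: "projection_op p \<and> range (blinfun_apply p) = S"
    using projection_onto_exists [OF assms] by blast
  then have "projection_onto S = p"
    unfolding projection_onto_def by (rule the_equality) (use p in \<open>auto intro!: projection_op_eqI\<close>)
  with p show "projection_op (projection_onto S)" "range (blinfun_apply (projection_onto S)) = S"
    by auto
qed

lemma projection_onto_apply_eqI:
  assumes S: "csubspace S" "closed S" and "y \<in> S" "\<And>s. s \<in> S \<Longrightarrow> cinner (x - y) s = 0"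
  shows "projection_onto S x = y"
proof (rule cinner_eqI)
  fix z
  note p = projection_onto [OF S]
  have y: "projection_onto S y = y"
    using p \<open>y \<in> S\<close> projection_op_idem by (metis rangeE)
  have "cinner (projection_onto S (x - y)) z = cinner (x - y) (projection_onto S z)"
    by (intro selfadjoint_opD projection_op_selfadjoint p)
  also have "\<dots> = 0"
    using assms(4) p(2) by blast
  finally show "cinner (projection_onto S x) z = cinner y z"
    by (simp add: blinfun.diff_right y cinner.diff_left)
qed

section \<open>Positive operators and their quadratic forms\<close>

lemma positive_op_bounded: "positive_op a \<Longrightarrow> a \<in> bounded_ops"
  by (simp add: positive_op_def)

text \<open>Polarization: a quadratic form with only real values comes from a Hermitian sesquilinear
  form. The vectors \<open>x + y\<close> and \<open>\<i> *\<^sub>C x + y\<close> give the imaginary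
  and the real part of the symmetry.\<close>

lemma positive_op_selfadjoint:
  fixes a :: "'h::complex_hilbert \<Rightarrow>\<^sub>L 'h"
  assumes a: "positive_op a"
  shows "selfadjoint_op a"
proof (rule selfadjoint_opI)
  show bd: "a \<in> bounded_ops"
    using a by (rule positive_op_bounded)
  fix x y
  have im: "Im (cinner (a x) x) = 0" for x
    using a by (simp add: positive_op_def complex_nonneg_Reals_iff)
  have 1: "Im (cinner (a x) y) + Im (cinner (a y) x) = 0" for x y
    using im [of "x + y"] im [of x] im [of y] by (simp add: blinfun.add_right cinner.add_left cinner.add_right)
  have "Re (cinner (a y) x) = Re (cinner (a x) y)"
    using 1 [of "\<i> *\<^sub>C x" y] by (simp add: bounded_opsD [OF bd] cinner_scaleC_left cinner_scaleC_right)
  then have "cinner (a x) y = cnj (cinner (a y) x)"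
    using 1 [of x y] by (simp add: complex_eq_iff)
  then show "cinner (a x) y = cinner x (a y)"
    using cinner_commute [of x "a y"] by simp
qed

lemma positive_op_iff: "positive_op a \<longleftrightarrow> selfadjoint_op a \<and> (\<forall>x. 0 \<le> Re (cinner (a x) x))"
proof
  assume a: "selfadjoint_op a \<and> (\<forall>x. 0 \<le> Re (cinner (a x) x))"
  then have "cinner (a x) x = cnj (cinner (a x) x)" for x
    using selfadjoint_opD [of a x x] cinner_commute [of x "a x"] by simp
  then have "Im (cinner (a x) x) = 0" for x
    by (metis complex_cnj_cancel_iff cnj.simps(2) complex.sel(2) equal_neg_zero)
  then show "positive_op a"
    using a by (simp add: positive_op_def selfadjoint_op_bounded complex_nonneg_Reals_iff)
qed (auto simp: positive_op_selfadjoint, simp add: positive_op_def complex_nonneg_Reals_iff)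

lemma op_le_iff:
  "selfadjoint_op a \<Longrightarrow> selfadjoint_op b \<Longrightarrow>
    op_le a b \<longleftrightarrow> (\<forall>x. Re (cinner (a x) x) \<le> Re (cinner (b x) x))"
  by (simp add: op_le_def positive_op_iff selfadjoint_op_diff blinfun.diff_left cinner.diff_left)

lemma op_le_trans:
  assumes "op_le a b" "op_le b c"
  shows "op_le a c"
proof -
  have "c - a = (c - b) + (b - a)"
    by simp
  then show ?thesis
    using assms unfolding op_le_def positive_op_iff
    by (metis add_nonneg_nonneg blinfun.add_left cinner.add_left plus_complex.sel(1) selfadjoint_op_add)
qed

text \<open>The form at \<open>x + r *\<^sub>R y\<close> is a quadratic polynomial in the real
  number \<open>r\<close> that is never negative, so its discriminant is not positive.\<close>

lemma positive_op_cauchy_schwarz: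
  fixes a :: "'h::complex_hilbert \<Rightarrow>\<^sub>L 'h"
  assumes a: "positive_op a"
  shows "(Re (cinner (a x) y))\<^sup>2 \<le> Re (cinner (a x) x) * Re (cinner (a y) y)"
proof -
  have "0 \<le> Re (cinner (a x) x) + 2 * Re (cinner (a x) y) * r + Re (cinner (a y) y) * r\<^sup>2" for r :: real
  proof -
    have "Re (cinner (a y) x) = Re (cinner (a x) y)"
      using selfadjoint_opD [OF positive_op_selfadjoint [OF a], of y x]
        arg_cong [OF cinner_commute [of "a x" y], of Re] by simp
    moreover have "0 \<le> Re (cinner (a (x + r *\<^sub>R y)) (x + r *\<^sub>R y))"
      using a by (simp add: positive_op_iff)
    ultimately show ?thesis
      by (simp add: blinfun.add_right blinfun.scaleR_right cinner.add_left cinner.add_right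
          cinner.scaleR_left cinner.scaleR_right power2_eq_square algebra_simps)
  qed
  note quad = this
  define \<alpha> where "\<alpha> = Re (cinner (a x) x)"
  define \<beta> where "\<beta> = Re (cinner (a x) y)"
  define \<gamma> where "\<gamma> = Re (cinner (a y) y)"
  have nn: "\<gamma> \<ge> 0" "\<alpha> \<ge> 0"
    using a by (auto simp: \<gamma>_def \<alpha>_def positive_op_iff)
  have q: "0 \<le> \<alpha> + 2 * \<beta> * r + \<gamma> * r\<^sup>2" for r
    using quad by (simp add: \<alpha>_def \<beta>_def \<gamma>_def)
  have "\<beta>\<^sup>2 \<le> \<alpha> * \<gamma>"
  proof (cases "\<gamma> = 0")
    case True
    then have "\<beta> = 0"
      \<comment> \<open>With \<open>\<gamma> = 0\<close> the polynomial is affine, and at this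
        argument it would take the value -1.\<close>
      using q [of "- (\<alpha> + 1) / (2 * \<beta>)"] nn by (cases "\<beta> = 0") auto
    then show ?thesis
      using True by simp
  next
    case False
    then have "0 \<le> \<gamma> * (\<alpha> + 2 * \<beta> * (- \<beta> / \<gamma>) + \<gamma> * (- \<beta> / \<gamma>)\<^sup>2)"
      using q [of "- \<beta> / \<gamma>"] nn by (intro mult_nonneg_nonneg) auto
    also have "\<dots> = \<alpha> * \<gamma> - \<beta>\<^sup>2"
      using False by (simp add: field_simps power2_eq_square)
    finally show ?thesis
      by simp
  qed
  then show ?thesis
    by (simp add: \<alpha>_def \<beta>_def \<gamma>_def)
qed

text \<open>Cauchy-Schwarz for the form of \<open>a\<close>, applied to \<open>x\<close> and
  \<open>a x\<close>. It bounds a norm by a quadratic form, which lets monotone convergence of forms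
  yield strong convergence of operators.\<close>

lemma positive_op_norm_sq_le:
  fixes a :: "'h::complex_hilbert \<Rightarrow>\<^sub>L 'h"
  assumes a: "positive_op a" and C: "\<And>x. Re (cinner (a x) x) \<le> C * (norm x)\<^sup>2"
  shows "(norm (a x))\<^sup>2 \<le> C * Re (cinner (a x) x)"
proof (cases "a x = 0")
  case False
  have "((norm (a x))\<^sup>2)\<^sup>2 \<le> Re (cinner (a x) x) * Re (cinner (a (a x)) (a x))"
    using positive_op_cauchy_schwarz [OF a, of x "a x"] by (simp add: Re_cinner_self)
  also have "\<dots> \<le> Re (cinner (a x) x) * (C * (norm (a x))\<^sup>2)"
    using a C by (intro mult_left_mono) (auto simp: positive_op_iff)
  finally have "(norm (a x))\<^sup>2 * (norm (a x))\<^sup>2 \<le> (norm (a x))\<^sup>2 * (C * Re (cinner (a x) x))"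
    by (simp add: power2_eq_square mult_ac)
  then show ?thesis
    by (rule mult_left_le_imp_le) (use False in simp)
qed simp

text \<open>The form of the positive operator \<open>b - a\<close> is bounded by 0, so the preceding
  norm estimate applies with constant 0.\<close>

lemma op_le_antisym:
  fixes a b :: "'h::complex_hilbert \<Rightarrow>\<^sub>L 'h"
  assumes "op_le a b" "op_le b a"
  shows "a = b"
proof (rule blinfun_eqI)
  fix x
  have pos: "positive_op (b - a)"
    using assms(1) by (simp add: op_le_def)
  have "Re (cinner ((b - a) x) x) \<le> 0 * (norm x)\<^sup>2" for x
    using assms(2) by (simp add: op_le_def positive_op_iff blinfun.diff_left cinner.diff_left)
  from positive_op_norm_sq_le [OF pos this, of x] show "a x = b x"
    by (simp add: blinfun.diff_left)
qed

lemma positive_op_norm_le: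
  fixes a :: "'h::complex_hilbert \<Rightarrow>\<^sub>L 'h"
  assumes a: "positive_op a" and C: "\<And>x. Re (cinner (a x) x) \<le> C * (norm x)\<^sup>2" and "C \<ge> 0"
  shows "norm (a x) \<le> C * norm x"
proof -
  have "(norm (a x))\<^sup>2 \<le> C * (C * (norm x)\<^sup>2)"
    using positive_op_norm_sq_le [OF a C] mult_left_mono [OF C \<open>C \<ge> 0\<close>] by (rule order_trans)
  then have "(norm (a x))\<^sup>2 \<le> (C * norm x)\<^sup>2"
    by (simp add: power2_eq_square mult_ac)
  then show ?thesis
    using \<open>C \<ge> 0\<close> power2_le_imp_le by fastforce
qed

lemma Re_cinner_le_norm:
  fixes a :: "'h::complex_hilbert \<Rightarrow>\<^sub>L 'h"
  shows "Re (cinner (a x) x) \<le> norm a * (norm x)\<^sup>2"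
proof -
  have "Re (cinner (a x) x) \<le> norm (a x) * norm x"
    by (meson abs_Re_le_cmod abs_le_D1 cinner_cauchy_schwarz order_trans)
  also have "\<dots> \<le> norm a * norm x * norm x"
    by (intro mult_right_mono norm_blinfun) auto
  finally show ?thesis
    by (simp add: power2_eq_square mult_ac)
qed

section \<open>Strong limits of nets\<close>

text \<open>The filter of tails of a net. It serves two index sets: time partitions ordered by
  inclusion, and directed families of operators ordered by \<open>op_le\<close>.\<close>

definition net_at_top :: "'i set \<Rightarrow> ('i \<Rightarrow> 'i \<Rightarrow> bool) \<Rightarrow> 'i filter" where
  "net_at_top I r = (INF i\<in>I. principal {j \<in> I. r i j})"

definition directed_by :: "'i set \<Rightarrow> ('i \<Rightarrow> 'i \<Rightarrow> bool) \<Rightarrow> bool" where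
  "directed_by I r \<longleftrightarrow> I \<noteq> {} \<and> (\<forall>i\<in>I. \<forall>j\<in>I. \<exists>k\<in>I. r i k \<and> r j k) \<and> transp r"

lemma eventually_net_at_top:
  assumes "directed_by I r"
  shows "eventually P (net_at_top I r) \<longleftrightarrow> (\<exists>i\<in>I. \<forall>j\<in>I. r i j \<longrightarrow> P j)"
proof -
  have "eventually P (net_at_top I r) \<longleftrightarrow> (\<exists>i\<in>I. eventually P (principal {j \<in> I. r i j}))"
    unfolding net_at_top_def
  proof (rule eventually_INF_base)
    fix i j assume "i \<in> I" "j \<in> I"
    then obtain k where k: "k \<in> I" "r i k" "r j k"
      using assms by (auto simp: directed_by_def)
    then have "{l \<in> I. r k l} \<subseteq> {l \<in> I. r i l} \<inter> {l \<in> I. r j l}"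
      using assms by (auto simp: directed_by_def dest: transpD)
    with k show "\<exists>x\<in>I. principal {l \<in> I. r x l} \<le> inf (principal {l \<in> I. r i l}) (principal {l \<in> I. r j l})"
      by (intro bexI [of _ k]) (simp_all only: inf_principal principal_le_iff)
  qed (use assms in \<open>simp add: directed_by_def\<close>)
  then show ?thesis
    by (auto simp: eventually_principal)
qed

lemma eventually_net_at_topI:
  "directed_by I r \<Longrightarrow> i \<in> I \<Longrightarrow> (\<And>j. j \<in> I \<Longrightarrow> r i j \<Longrightarrow> P j) \<Longrightarrow> eventually P (net_at_top I r)"
  by (auto simp: eventually_net_at_top)

lemma net_at_top_not_bot: "directed_by I r \<Longrightarrow> net_at_top I r \<noteq> bot"
  unfolding trivial_limit_def by (auto simp: eventually_net_at_top directed_by_def)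

text \<open>The index sets here are not sequences, so completeness is used in its form for Cauchy
  filters.\<close>

lemma cauchy_net_converges:
  fixes f :: "'i \<Rightarrow> 'h::{complete_space,metric_space}"
  assumes "F \<noteq> bot"
    and "\<And>e. e > 0 \<Longrightarrow> \<exists>P. eventually P F \<and> (\<forall>i j. P i \<and> P j \<longrightarrow> dist (f i) (f j) < e)"
  shows "\<exists>l. (f \<longlongrightarrow> l) F"
proof -
  have "cauchy_filter (filtermap f F)"
    using assms(2) by (simp add: cauchy_filter_metric_filtermap)
  moreover have "filtermap f F \<noteq> bot"
    using assms(1) by (simp add: filtermap_bot_iff)
  ultimately obtain l where "filtermap f F \<le> nhds l"
    using complete_UNIV [where 'a = 'h] unfolding complete_uniform by (metis principal_UNIV top_greatest top_set_def)
  then show ?thesis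
    by (auto simp: filterlim_def)
qed

text \<open>Approximating \<open>x\<close> by \<open>d\<close> in the dense set changes
  \<open>T i x\<close> by a small amount uniformly in \<open>i\<close>, so convergence on the dense
  set gives the Cauchy property everywhere. The pointwise limit inherits complex linearity and the
  bound \<open>K\<close>.\<close>

lemma bounded_net_strong_limit:
  fixes T :: "'i \<Rightarrow> 'h::complex_hilbert \<Rightarrow>\<^sub>L 'h"
  assumes F: "F \<noteq> bot"
    and bound: "eventually (\<lambda>i. norm (T i) \<le> K) F"
    and ops: "eventually (\<lambda>i. T i \<in> bounded_ops) F"
    and dense: "closure D = UNIV"
    and conv: "\<And>d. d \<in> D \<Longrightarrow> \<exists>l. ((\<lambda>i. T i d) \<longlongrightarrow> l) F"
  shows "\<exists>T0\<in>bounded_ops. \<forall>x. ((\<lambda>i. T i x) \<longlongrightarrow> T0 x) F"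
proof -
  have "\<exists>l. ((\<lambda>i. T i x) \<longlongrightarrow> l) F" for x
  proof (rule cauchy_net_converges [OF F])
    fix e :: real assume "e > 0"
    \<comment> \<open>A strictly positive bound above \<open>K\<close>, by which the tolerance can
      be divided.\<close>
    define K' where "K' = max K 0 + 1"
    have K': "K' > 0" "K \<le> K'"
      by (auto simp: K'_def)
    define \<delta> where "\<delta> = e / (4 * K')"
    have \<delta>: "\<delta> > 0" "K' * \<delta> = e / 4"
      using K' \<open>e > 0\<close> by (auto simp: \<delta>_def)
    then obtain d where d: "d \<in> D" "norm (x - d) < \<delta>"
      using dense closure_approachable [of x D] by (auto simp: dist_norm norm_minus_commute)
    obtain l where l: "((\<lambda>i. T i d) \<longlongrightarrow> l) F"
      using conv d by blast
    have "eventually (\<lambda>i. dist (T i d) l < e / 4) F"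
      using tendstoD [OF l, of "e / 4"] \<open>e > 0\<close> by simp
    with bound have ev: "eventually (\<lambda>i. norm (T i) \<le> K \<and> dist (T i d) l < e / 4) F"
      by (rule eventually_conj)
    have near: "dist (T i x) l < e / 2" if "norm (T i) \<le> K" "dist (T i d) l < e / 4" for i
    proof -
      have "dist (T i x) (T i d) \<le> norm (T i) * norm (x - d)"
        by (simp add: dist_norm norm_blinfun flip: blinfun.diff_right)
      also have "\<dots> \<le> K' * \<delta>"
        using that K' d by (intro mult_mono) auto
      finally show ?thesis
        using that dist_triangle [of "T i x" l "T i d"] \<delta> by linarith
    qed
    have "dist (T i x) (T j x) < e"
      if "norm (T i) \<le> K \<and> dist (T i d) l < e / 4" "norm (T j) \<le> K \<and> dist (T j d) l < e / 4" for i j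
      using near [of i] near [of j] that dist_triangle2 [of "T i x" "T j x" l] by linarith
    with ev show "\<exists>P. eventually P F \<and> (\<forall>i j. P i \<and> P j \<longrightarrow> dist (T i x) (T j x) < e)"
      by blast
  qed
  then obtain L where L: "\<And>x. ((\<lambda>i. T i x) \<longlongrightarrow> L x) F"
    by metis
  have add: "L (x + y) = L x + L y" for x y
    using tendsto_unique [OF F L [of "x + y"]] tendsto_add [OF L [of x] L [of y]]
    by (simp add: blinfun.add_right)
  have scale: "L (c *\<^sub>C x) = c *\<^sub>C L x" for c x
  proof (rule tendsto_unique [OF F L])
    have "eventually (\<lambda>i. c *\<^sub>C T i x = T i (c *\<^sub>C x)) F"
      using ops by eventually_elim (simp add: bounded_opsD)
    then show "((\<lambda>i. T i (c *\<^sub>C x)) \<longlongrightarrow> c *\<^sub>C L x) F"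
      by (rule Lim_transform_eventually [OF bounded_linear.tendsto [OF bounded_linear_scaleC L]])
  qed
  have "norm (L x) \<le> norm x * K" for x
  proof (rule tendsto_upperbound [OF tendsto_norm [OF L] _ F])
    show "eventually (\<lambda>i. norm (T i x) \<le> norm x * K) F"
      using bound
    proof eventually_elim
      case (elim i)
      then have "norm (T i) * norm x \<le> K * norm x"
        by (intro mult_right_mono) auto
      then show ?case
        using norm_blinfun [of "T i" x] by (simp add: mult.commute)
    qed
  qed
  then have "bounded_linear L"
    using scale [of "of_real _"] by (intro bounded_linear_intro [of L K] add) (simp_all add: scaleC_of_real)
  then show ?thesis
    using L scale by (intro bexI [of _ "Blinfun L"]) (auto simp: bounded_ops_def bounded_linear_Blinfun_apply)
qed

text \<open>Monotone convergence for operators. The quadratic forms increase to a finite supremum,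
  hence are Cauchy; \<open>positive_op_norm_sq_le\<close> converts small differences of forms into
  small differences of vectors.\<close>

lemma increasing_net_strong_limit:
  fixes T :: "'i \<Rightarrow> 'h::complex_hilbert \<Rightarrow>\<^sub>L 'h"
  assumes dir: "directed_by I r"
    and sa: "\<And>i. i \<in> I \<Longrightarrow> selfadjoint_op (T i)" "selfadjoint_op S"
    and mono: "\<And>i j. i \<in> I \<Longrightarrow> j \<in> I \<Longrightarrow> r i j \<Longrightarrow> op_le (T i) (T j)"
    and bound: "\<And>i. i \<in> I \<Longrightarrow> op_le (T i) S"
  shows "\<exists>T0\<in>bounded_ops. \<forall>x. ((\<lambda>i. T i x) \<longlongrightarrow> T0 x) (net_at_top I r)"
proof -
  obtain i0 where i0: "i0 \<in> I"
    using dir by (auto simp: directed_by_def)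
  \<comment> \<open>One constant for all differences \<open>T j - T i\<close> beyond
    \<open>i0\<close>: their forms are dominated by that of \<open>S - T i0\<close>.\<close>
  define C where "C = norm (S - T i0)"
  define f where "f x i = Re (cinner (T i x) x)" for x i
  have f_mono: "f x i \<le> f x j" if "i \<in> I" "j \<in> I" "r i j" for x i j
    using mono that sa by (simp add: op_le_iff f_def)
  have f_bound: "f x i \<le> Re (cinner (S x) x)" if "i \<in> I" for x i
    using bound that sa by (simp add: op_le_iff f_def)
  have pos: "positive_op (T j - T i)" if "i \<in> I" "j \<in> I" "r i j" for i j
    using mono [OF that] by (simp add: op_le_def)
  have form: "Re (cinner ((T j - T i) x) x) \<le> C * (norm x)\<^sup>2"
    if "i \<in> I" "j \<in> I" "f x i0 \<le> f x i" for i j x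
  proof -
    have "Re (cinner ((T j - T i) x) x) \<le> Re (cinner ((S - T i0) x) x)"
      using f_bound [OF that(2), of x] that(3) by (simp add: f_def blinfun.diff_left cinner.diff_left)
    also have "\<dots> \<le> C * (norm x)\<^sup>2"
      unfolding C_def by (rule Re_cinner_le_norm)
    finally show ?thesis .
  qed
  show ?thesis
  proof (rule bounded_net_strong_limit [where D = UNIV])
    show nb: "net_at_top I r \<noteq> bot"
      by (rule net_at_top_not_bot [OF dir])
    show "eventually (\<lambda>i. norm (T i) \<le> norm (T i0) + C) (net_at_top I r)"
    proof (rule eventually_net_at_topI [OF dir i0])
      fix j assume j: "j \<in> I" "r i0 j"
      have "norm (T j - T i0) \<le> C"
        using positive_op_norm_le [OF pos [OF i0 j] form [OF i0 j(1)]]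
        by (intro norm_blinfun_bound) (auto simp: C_def)
      then show "norm (T j) \<le> norm (T i0) + C"
        using norm_triangle_ineq [of "T i0" "T j - T i0"] by simp
    qed
    show "eventually (\<lambda>i. T i \<in> bounded_ops) (net_at_top I r)"
      by (rule eventually_net_at_topI [OF dir i0]) (auto intro: selfadjoint_op_bounded sa)
    fix x
    show "\<exists>l. ((\<lambda>i. T i x) \<longlongrightarrow> l) (net_at_top I r)"
    proof (rule cauchy_net_converges [OF nb])
      fix e :: real assume "e > 0"
      \<comment> \<open>The summand 1 makes \<open>C * \<delta>\<close> strictly smaller than
        \<open>(e / 2)\<^sup>2\<close> and covers \<open>C = 0\<close>.\<close>
      define \<delta> where "\<delta> = (e / 2)\<^sup>2 / (C + 1)"
      have C: "C \<ge> 0"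
        by (simp add: C_def)
      with \<open>e > 0\<close> have \<delta>: "\<delta> > 0" "C * \<delta> < (e / 2)\<^sup>2"
        by (auto simp: \<delta>_def field_simps)
      have bdd: "bdd_above (f x ` I)"
        using f_bound by (intro bdd_aboveI2)
      obtain i1 where i1: "i1 \<in> I" "(SUP i\<in>I. f x i) - \<delta> < f x i1"
        using less_cSupD [of "f x ` I" "(SUP i\<in>I. f x i) - \<delta>"] i0 \<delta> by auto
      \<comment> \<open>Beyond \<open>i0\<close> the constant \<open>C\<close> is valid; beyond
        \<open>i1\<close> the form at \<open>x\<close> is within \<open>\<delta>\<close> of its
        supremum.\<close>
      obtain k where k: "k \<in> I" "r i0 k" "r i1 k"
        using dir i0 i1 by (auto simp: directed_by_def)
      have near: "dist (T j x) (T k x) < e / 2" if j: "j \<in> I" "r k j" for j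
      proof -
        have "(norm ((T j - T k) x))\<^sup>2 \<le> C * Re (cinner ((T j - T k) x) x)"
        proof (rule positive_op_norm_sq_le [OF pos [OF k(1) j]])
          show "Re (cinner ((T j - T k) x) x) \<le> C * (norm x)\<^sup>2" for x
            using form [OF k(1) j(1)] f_mono [OF i0 k(1,2)] by blast
        qed
        also have "\<dots> \<le> C * \<delta>"
        proof (rule mult_left_mono [OF _ C])
          have "f x j \<le> (SUP i\<in>I. f x i)"
            using bdd j by (intro cSUP_upper)
          then show "Re (cinner ((T j - T k) x) x) \<le> \<delta>"
            using i1 f_mono [OF i1(1) k(1,3), of x] by (simp add: f_def blinfun.diff_left cinner.diff_left)
        qed
        finally have "(norm ((T j - T k) x))\<^sup>2 < (e / 2)\<^sup>2"
          using \<delta> by simp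
        then show ?thesis
          using \<open>e > 0\<close> power_less_imp_less_base [of _ 2 "e / 2"] by (simp add: dist_norm blinfun.diff_left)
      qed
      have "eventually (\<lambda>j. dist (T j x) (T k x) < e / 2) (net_at_top I r)"
        by (rule eventually_net_at_topI [OF dir k(1)]) (rule near)
      moreover have "dist (T i x) (T j x) < e"
        if "dist (T i x) (T k x) < e / 2 \<and> dist (T j x) (T k x) < e / 2" for i j
        using that dist_triangle2 [of "T i x" "T j x" "T k x"] by linarith
      ultimately show "\<exists>P. eventually P (net_at_top I r) \<and> (\<forall>i j. P i \<and> P j \<longrightarrow> dist (T i x) (T j x) < e)"
        by blast
    qed
  qed simp
qed

section \<open>Commutants and von Neumann algebras\<close>

lemma commutant_iff: "b \<in> commutant S \<longleftrightarrow> b \<in> bounded_ops \<and> (\<forall>a\<in>S. \<forall>x. a (b x) = b (a x))"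
proof -
  have "a o\<^sub>L b = b o\<^sub>L a \<longleftrightarrow> (\<forall>x. a (b x) = b (a x))" for a
    by (metis blinfun_apply_blinfun_compose blinfun_eqI)
  then show ?thesis
    by (simp add: commutant_def)
qed

lemma commutant_bounded: "commutant S \<subseteq> bounded_ops"
  by (auto simp: commutant_def)

lemma commutant_add: "a \<in> commutant S \<Longrightarrow> b \<in> commutant S \<Longrightarrow> a + b \<in> commutant S"
  by (auto simp: commutant_iff blinfun.add_left blinfun.add_right bounded_ops_add)

lemma commutant_diff: "a \<in> commutant S \<Longrightarrow> b \<in> commutant S \<Longrightarrow> a - b \<in> commutant S"
  by (auto simp: commutant_iff blinfun.diff_left blinfun.diff_right bounded_ops_diff)

lemma commutant_scaleC: "S \<subseteq> bounded_ops \<Longrightarrow> a \<in> commutant S \<Longrightarrow> c *\<^sub>C a \<in> commutant S"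
  by (auto simp: commutant_iff scaleC_blinfun.rep_eq bounded_ops_scaleC bounded_opsD subset_iff)

lemma commutant_compose: "a \<in> commutant S \<Longrightarrow> b \<in> commutant S \<Longrightarrow> a o\<^sub>L b \<in> commutant S"
  by (auto simp: commutant_iff bounded_ops_compose)

lemma commutant_id: "id_blinfun \<in> commutant S"
  by (auto simp: commutant_iff bounded_ops_id)

lemma commutant_zero: "0 \<in> commutant S"
  by (auto simp: commutant_iff bounded_ops_zero blinfun.zero_right)

lemma commutant_antimono: "S \<subseteq> T \<Longrightarrow> commutant T \<subseteq> commutant S"
  by (auto simp: commutant_def)

lemma subset_double_commutant: "S \<subseteq> bounded_ops \<Longrightarrow> S \<subseteq> commutant (commutant S)"
  by (auto simp: commutant_iff)

lemma triple_commutant: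
  "S \<subseteq> bounded_ops \<Longrightarrow> commutant (commutant (commutant S)) = commutant S"
  by (meson commutant_antimono commutant_bounded subset_antisym subset_double_commutant)

lemma commutant_adjoint:
  assumes S: "S \<subseteq> bounded_ops" "\<And>a. a \<in> S \<Longrightarrow> adjoint_op a \<in> S" and b: "b \<in> commutant S"
  shows "adjoint_op b \<in> commutant S"
proof -
  have bb: "b \<in> bounded_ops"
    using b commutant_bounded by blast
  have "a (adjoint_op b x) = adjoint_op b (a x)" if a: "a \<in> S" for a x
  proof (rule cinner_eqI)
    fix z
    have "cinner (a (adjoint_op b x)) z = cinner x (b (adjoint_op a z))"
      using a S bb by (simp add: cinner_adjoint cinner_adjoint' subset_iff)
    also have "\<dots> = cinner x (adjoint_op a (b z))"
      using S(2) [OF a] b by (simp add: commutant_iff)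
    also have "\<dots> = cinner (adjoint_op b (a x)) z"
      using a S bb by (simp add: cinner_adjoint [symmetric] cinner_adjoint' subset_iff)
    finally show "cinner (a (adjoint_op b x)) z = cinner (adjoint_op b (a x)) z" .
  qed
  then show ?thesis
    using bb by (simp add: commutant_iff adjoint_op_bounded)
qed

text \<open>The route by which \<open>B_tau\<close> and \<open>A_tau\<close> are recognized as von
  Neumann algebras: each is written as the commutant of an adjoint-closed set.\<close>

lemma von_neumann_algebra_commutant:
  assumes "S \<subseteq> bounded_ops" "\<And>a. a \<in> S \<Longrightarrow> adjoint_op a \<in> S"
  shows "von_neumann_algebra (commutant S)"
  using commutant_adjoint [OF assms] commutant_bounded triple_commutant [OF assms(1)]
  by (auto simp: von_neumann_algebra_def)

lemma commutant_strong_limit: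
  assumes F: "F \<noteq> bot" and T: "eventually (\<lambda>i. T i \<in> commutant S) F"
    and T0: "T0 \<in> bounded_ops" and lim: "\<And>x. ((\<lambda>i. T i x) \<longlongrightarrow> T0 x) F"
  shows "T0 \<in> commutant S"
  unfolding commutant_iff
proof (intro conjI ballI allI T0)
  fix a x assume a: "a \<in> S"
  show "a (T0 x) = T0 (a x)"
  proof (rule tendsto_unique [OF F _ lim])
    have "eventually (\<lambda>i. a (T i x) = T i (a x)) F"
      using T by eventually_elim (use a in \<open>simp add: commutant_iff\<close>)
    then show "((\<lambda>i. T i (a x)) \<longlongrightarrow> a (T0 x)) F"
      by (rule Lim_transform_eventually [OF bounded_linear.tendsto [OF blinfun.bounded_linear_right lim]])
  qed
qed

context
  fixes A :: "('h::complex_hilbert \<Rightarrow>\<^sub>L 'h) set"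
  assumes A: "von_neumann_algebra A"
begin

lemma vna_bounded: "a \<in> A \<Longrightarrow> a \<in> bounded_ops"
  using A by (auto simp: von_neumann_algebra_def)

lemma vna_adjoint: "a \<in> A \<Longrightarrow> adjoint_op a \<in> A"
  using A by (auto simp: von_neumann_algebra_def)

lemma vna_double_commutant: "commutant (commutant A) = A"
  using A by (auto simp: von_neumann_algebra_def)

lemma vna_add: "a \<in> A \<Longrightarrow> b \<in> A \<Longrightarrow> a + b \<in> A"
  using commutant_add [of a "commutant A" b] by (simp add: vna_double_commutant)

lemma vna_diff: "a \<in> A \<Longrightarrow> b \<in> A \<Longrightarrow> a - b \<in> A"
  using commutant_diff [of a "commutant A" b] by (simp add: vna_double_commutant)

lemma vna_compose: "a \<in> A \<Longrightarrow> b \<in> A \<Longrightarrow> a o\<^sub>L b \<in> A"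
  using commutant_compose [of a "commutant A" b] by (simp add: vna_double_commutant)

lemma vna_id: "id_blinfun \<in> A"
  using commutant_id [of "commutant A"] by (simp add: vna_double_commutant)

lemma vna_zero: "0 \<in> A"
  using commutant_zero [of "commutant A"] by (simp add: vna_double_commutant)

lemma vna_scaleC: "a \<in> A \<Longrightarrow> c *\<^sub>C a \<in> A"
  using commutant_scaleC [OF commutant_bounded, of a A c] by (simp add: vna_double_commutant)

lemma vna_sum: "(\<And>i. i \<in> I \<Longrightarrow> f i \<in> A) \<Longrightarrow> sum f I \<in> A"
  by (induction I rule: infinite_finite_induct) (auto simp: vna_zero vna_add)

lemma vna_commutant: "von_neumann_algebra (commutant A)"
  by (rule von_neumann_algebra_commutant) (auto simp: vna_bounded vna_adjoint)

lemma vna_strong_limit: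
  "F \<noteq> bot \<Longrightarrow> eventually (\<lambda>i. T i \<in> A) F \<Longrightarrow> T0 \<in> bounded_ops \<Longrightarrow>
    (\<And>x. ((\<lambda>i. T i x) \<longlongrightarrow> T0 x) F) \<Longrightarrow> T0 \<in> A"
  using commutant_strong_limit [of F T "commutant A" T0] by (simp add: vna_double_commutant)

lemma csubspace_orbit: "csubspace ((\<lambda>a. blinfun_apply a \<Omega>) ` A)"
  unfolding csubspace_def
proof (intro conjI ballI allI)
  show "0 \<in> (\<lambda>a. blinfun_apply a \<Omega>) ` A"
    using vna_zero by (intro rev_image_eqI [of 0]) auto
next
  fix x y assume "x \<in> (\<lambda>a. blinfun_apply a \<Omega>) ` A" "y \<in> (\<lambda>a. blinfun_apply a \<Omega>) ` A"
  then show "x + y \<in> (\<lambda>a. blinfun_apply a \<Omega>) ` A"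
    by (auto simp: vna_add simp flip: blinfun.add_left)
next
  fix c x assume "x \<in> (\<lambda>a. blinfun_apply a \<Omega>) ` A"
  then show "c *\<^sub>C x \<in> (\<lambda>a. blinfun_apply a \<Omega>) ` A"
    by (auto intro!: image_eqI [of _ _ "c *\<^sub>C _"] simp: vna_scaleC scaleC_blinfun.rep_eq)
qed

text \<open>The closed orbit is invariant under \<open>b\<close> and under its adjoint. Hence
  \<open>b\<close> also preserves the orthogonal complement, and
  \<open>b x = b (p x) + b (x - p x)\<close> is the orthogonal decomposition of
  \<open>b x\<close>.\<close>

lemma orbit_projection_commutes:
  fixes \<Omega> :: 'h
  assumes b: "b \<in> A"
  defines "p \<equiv> projection_onto (closure ((\<lambda>a. blinfun_apply a \<Omega>) ` A))"
  shows "p (b x) = b (p x)"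
proof -
  let ?O = "(\<lambda>a. blinfun_apply a \<Omega>) ` A"
  have S: "csubspace (closure ?O)" "closed (closure ?O)"
    by (auto intro: csubspace_closure csubspace_orbit)
  have inv: "b y \<in> closure ?O" if b: "b \<in> A" and y: "y \<in> closure ?O" for b y
  proof -
    obtain f where f: "\<forall>n. f n \<in> ?O" "f \<longlonglongrightarrow> y"
      using y by (auto simp: closure_sequential)
    have "b (f n) \<in> ?O" for n
      using f(1) [rule_format, of n] vna_compose [OF b]
      by (auto simp flip: blinfun_apply_blinfun_compose)
    moreover have "(\<lambda>n. b (f n)) \<longlonglongrightarrow> b y"
      by (rule bounded_linear.tendsto [OF blinfun.bounded_linear_right f(2)])
    ultimately show ?thesis
      unfolding closure_sequential by (intro exI [of _ "\<lambda>n. b (f n)"] conjI allI)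
  qed
  note p = projection_onto [OF S, folded p_def]
  have orth: "cinner (x - p x) s = 0" if s: "s \<in> closure ?O" for x s
  proof -
    obtain u where "s = p u"
      using s p(2) by blast
    then show ?thesis
      by (metis cinner.diff_left cinner.diff_right cinner.zero_right diff_self p(1) projection_op_idem
          projection_op_selfadjoint selfadjoint_opD)
  qed
  show ?thesis
  proof (rule projection_onto_apply_eqI [OF S, folded p_def])
    show "b (p x) \<in> closure ?O"
      by (rule inv [OF b]) (use p(2) in blast)
    fix s assume "s \<in> closure ?O"
    then have "cinner (x - p x) (adjoint_op b s) = 0"
      using b by (intro orth inv vna_adjoint)
    then show "cinner (b x - b (p x)) s = 0"
      using vna_bounded [OF b] by (simp add: cinner_adjoint flip: blinfun.diff_right)
  qed
qed

end

text \<open>The projection \<open>p\<close> onto the closed orbit of the commutant lies in the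
  double commutant, that is in \<open>A\<close>. Since \<open>id_blinfun - p\<close> annihilates
  \<open>\<Omega>\<close>, it vanishes because \<open>\<Omega>\<close> is separating.\<close>

lemma separating_imp_commutant_cyclic:
  assumes A: "von_neumann_algebra A" and sep: "separating_vector A \<Omega>"
  shows "closure ((\<lambda>a. blinfun_apply a \<Omega>) ` commutant A) = UNIV"
proof -
  let ?O = "(\<lambda>a. blinfun_apply a \<Omega>) ` commutant A"
  define p where "p = projection_onto (closure ?O)"
  have S: "csubspace (closure ?O)" "closed (closure ?O)"
    by (auto intro!: csubspace_closure csubspace_orbit vna_commutant A)
  note p = projection_onto [OF S, folded p_def]
  have "p \<in> commutant (commutant A)"
    using orbit_projection_commutes [OF vna_commutant [OF A]] p(1)
    by (auto simp: commutant_iff p_def projection_op_selfadjoint selfadjoint_op_bounded)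
  then have "id_blinfun - p \<in> A"
    by (simp add: vna_double_commutant [OF A] vna_diff [OF A] vna_id [OF A])
  moreover have "\<Omega> \<in> closure ?O"
    by (rule subsetD [OF closure_subset]) (auto intro!: image_eqI [of _ _ id_blinfun] commutant_id)
  then have "p \<Omega> = \<Omega>"
    using p projection_op_idem by (metis rangeE)
  ultimately have "id_blinfun - p = 0"
    using sep by (auto simp: separating_vector_def blinfun.diff_left)
  then have "range (blinfun_apply p) = UNIV"
    by (metis eq_iff_diff_eq_0 blinfun_apply_id_blinfun surj_id id_apply surjI)
  then show ?thesis
    using p by simp
qed

section \<open>Order and commutation of projections\<close>

lemma projection_op_bounded: "projection_op p \<Longrightarrow> p \<in> bounded_ops"
  by (simp add: projection_op_selfadjoint selfadjoint_op_bounded)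

lemma projection_op_cinner: "projection_op p \<Longrightarrow> cinner (p x) x = cinner (p x) (p x)"
  by (metis projection_op_idem projection_op_selfadjoint selfadjoint_opD)

lemma projection_op_positive: "projection_op p \<Longrightarrow> positive_op p"
  by (simp add: positive_op_iff projection_op_selfadjoint projection_op_cinner Re_cinner_self)

text \<open>The conclusion is the adjoint of the hypothesis.\<close>

lemma projection_op_absorb_commute:
  assumes "projection_op p" "projection_op p'" "\<And>x. p' (p x) = p x"
  shows "p (p' x) = p x"
proof (rule cinner_eqI)
  fix y
  have "cinner (p (p' x)) y = cinner x (p' (p y))"
    using assms by (simp add: projection_op_selfadjoint selfadjoint_opD)
  then show "cinner (p (p' x)) y = cinner (p x) y"
    using assms by (simp add: projection_op_selfadjoint selfadjoint_opD)
qed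

lemma projection_op_diff:
  assumes "projection_op p" "projection_op p'" "\<And>x. p' (p x) = p x"
  shows "projection_op (p' - p)"
proof (rule projection_opI)
  show "p' - p \<in> bounded_ops"
    using assms by (simp add: bounded_ops_diff projection_op_bounded)
  show "cinner ((p' - p) x) y = cinner x ((p' - p) y)" for x y
    using assms by (simp add: selfadjoint_opD selfadjoint_op_diff projection_op_selfadjoint)
  show "(p' - p) ((p' - p) x) = (p' - p) x" for x
    using assms projection_op_absorb_commute [OF assms]
    by (simp add: blinfun.diff_left blinfun.diff_right projection_op_idem)
qed

lemma projection_op_compose:
  assumes "projection_op p" "projection_op p'" and comm: "\<And>x. p' (p x) = p (p' x)"
  shows "projection_op (p o\<^sub>L p')"
proof (rule projection_opI)
  show "p o\<^sub>L p' \<in> bounded_ops"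
    using assms by (simp add: bounded_ops_compose projection_op_bounded)
  show "cinner ((p o\<^sub>L p') x) y = cinner x ((p o\<^sub>L p') y)" for x y
    using assms(1,2) by (simp add: comm [symmetric] projection_op_selfadjoint selfadjoint_opD)
  show "(p o\<^sub>L p') ((p o\<^sub>L p') x) = (p o\<^sub>L p') x" for x
    using assms(1,2) by (simp add: comm projection_op_idem)
qed

text \<open>The order gives \<open>norm (p y) \<le> norm (p' y)\<close>, so the kernel of
  \<open>p'\<close> is contained in that of \<open>p\<close>.\<close>

lemma projection_op_le_absorb:
  assumes p: "projection_op p" and p': "projection_op p'" and le: "op_le p p'"
  shows "p' (p x) = p x" "p (p' x) = p x"
proof -
  have norm: "norm (p y) \<le> norm (p' y)" for y
  proof -
    have "Re (cinner (p y) y) \<le> Re (cinner (p' y) y)"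
      using le p p' by (simp add: op_le_iff projection_op_selfadjoint)
    then show ?thesis
      using p p' by (simp add: projection_op_cinner Re_cinner_self)
  qed
  \<comment> \<open>The vector \<open>p' x - x\<close> is annihilated by \<open>p'\<close>, hence by
    \<open>p\<close>.\<close>
  have "p (p' x) = p x" for x
    using norm [of "p' x - x"] p' by (simp add: blinfun.diff_right projection_op_idem)
  then show "p (p' x) = p x" "p' (p x) = p x"
  proof -
    fix x
    \<comment> \<open>Passing to complements reverses the inclusion of ranges, so that
      \<open>projection_op_absorb_commute\<close> yields the other absorption law.\<close>
    have "projection_op (id_blinfun - p)" "projection_op (id_blinfun - p')"
      by (rule projection_op_diff; use p p' in \<open>simp add: projection_opI bounded_ops_id\<close>)+
    from projection_op_absorb_commute [OF this(2,1), of x] \<open>\<And>x. p (p' x) = p x\<close>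
    show "p' (p x) = p x"
      by (simp add: blinfun.diff_left blinfun.diff_right)
  qed
qed

lemma projection_op_range_subset_absorb:
  "projection_op p' \<Longrightarrow> range (blinfun_apply p) \<subseteq> range (blinfun_apply p') \<Longrightarrow> p' (p x) = p x"
  by (metis projection_op_idem rangeE rangeI subsetD)

lemma positive_op_add: "positive_op a \<Longrightarrow> positive_op b \<Longrightarrow> positive_op (a + b)"
  by (simp add: positive_op_iff selfadjoint_op_add blinfun.add_left cinner.add_left)

lemma positive_op_zero: "positive_op 0"
  by (simp add: positive_op_def bounded_ops_zero)

lemma positive_op_sum: "(\<And>i. i \<in> I \<Longrightarrow> positive_op (f i)) \<Longrightarrow> positive_op (sum f I)"
  by (induction I rule: infinite_finite_induct) (auto simp: positive_op_zero positive_op_add)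

lemma op_le_refl: "op_le a a"
  by (simp add: op_le_def positive_op_zero)

lemma scaleC_blinfun_of_real: "complex_of_real r *\<^sub>C (a :: 'h::complex_hilbert \<Rightarrow>\<^sub>L 'h) = r *\<^sub>R a"
  by (rule blinfun_eqI) (simp add: scaleC_blinfun.rep_eq scaleC_of_real blinfun.scaleR_left)

lemma norm_scaleC_blinfun_le: "norm (c *\<^sub>C (a :: 'h::complex_hilbert \<Rightarrow>\<^sub>L 'h)) \<le> cmod c * norm a"
proof (rule norm_blinfun_bound)
  fix x
  have "cmod c * norm (a x) \<le> cmod c * (norm a * norm x)"
    by (intro mult_left_mono norm_blinfun) auto
  then show "norm ((c *\<^sub>C a) x) \<le> cmod c * norm a * norm x"
    by (simp add: scaleC_blinfun.rep_eq norm_scaleC mult.assoc)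
qed simp

section \<open>Norm bounds for positive unital linear maps\<close>

context
  fixes B :: "('h::complex_hilbert \<Rightarrow>\<^sub>L 'h) set" and \<Phi> :: "'h \<Rightarrow>\<^sub>L 'h \<Rightarrow> 'h \<Rightarrow>\<^sub>L 'h"
  assumes B: "von_neumann_algebra B"
    and add: "\<And>x y. x \<in> B \<Longrightarrow> y \<in> B \<Longrightarrow> \<Phi> (x + y) = \<Phi> x + \<Phi> y"
    and scale: "\<And>c x. x \<in> B \<Longrightarrow> \<Phi> (c *\<^sub>C x) = c *\<^sub>C \<Phi> x"
    and pos: "\<And>x. x \<in> B \<Longrightarrow> positive_op x \<Longrightarrow> positive_op (\<Phi> x)"
    and unit: "\<Phi> id_blinfun = id_blinfun"
begin

text \<open>For self-adjoint \<open>x\<close> both \<open>norm x *\<^sub>R id_blinfun + x\<close>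
  and \<open>norm x *\<^sub>R id_blinfun - x\<close> are positive, and \<open>\<Phi>\<close>
  preserves positivity and the identity. The two signs are handled together by a real
  \<open>r\<close> of modulus 1.\<close>

lemma positive_unital_shift:
  assumes x: "x \<in> B" "selfadjoint_op x"
  shows "positive_op (norm x *\<^sub>R id_blinfun + \<Phi> x)" "positive_op (norm x *\<^sub>R id_blinfun - \<Phi> x)"
proof -
  note idB = vna_id [OF B] and scB = vna_scaleC [OF B]
  have p: "positive_op (of_real (norm x) *\<^sub>C id_blinfun + of_real r *\<^sub>C x)" if "\<bar>r\<bar> = 1" for r
    unfolding positive_op_iff scaleC_blinfun_of_real
  proof (intro conjI allI)
    show "selfadjoint_op (norm x *\<^sub>R id_blinfun + r *\<^sub>R x)"
      using x by (intro selfadjoint_op_add selfadjoint_op_scaleR selfadjoint_op_id)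
    fix y
    have "Re (cinner (- (r *\<^sub>R x) y) y) \<le> norm x * (norm y)\<^sup>2"
      using Re_cinner_le_norm [of "- (r *\<^sub>R x)" y] that by simp (simp add: blinfun.minus_left)
    then show "0 \<le> Re (cinner ((norm x *\<^sub>R id_blinfun + r *\<^sub>R x) y) y)"
      by (simp add: blinfun.add_left blinfun.minus_left blinfun.scaleR_left cinner.add_left cinner.minus_left
          cinner.scaleR_left Re_cinner_self)
  qed
  have "positive_op (of_real (norm x) *\<^sub>C id_blinfun + of_real r *\<^sub>C \<Phi> x)" if "\<bar>r\<bar> = 1" for r
    using pos [OF _ p [OF that]] x by (simp add: add scale unit idB scB vna_add [OF B])
  from this [of 1] this [of "- 1"]
  show "positive_op (norm x *\<^sub>R id_blinfun + \<Phi> x)" "positive_op (norm x *\<^sub>R id_blinfun - \<Phi> x)"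
    unfolding scaleC_blinfun_of_real by simp_all
qed

lemma positive_unital_selfadjoint:
  assumes x: "x \<in> B" "selfadjoint_op x"
  shows "selfadjoint_op (\<Phi> x)"
  using selfadjoint_op_diff [OF positive_op_selfadjoint [OF positive_unital_shift(1) [OF x]]
      selfadjoint_op_scaleR [OF selfadjoint_op_id, of "norm x"]]
  by simp

text \<open>The shifted operator lies between 0 and \<open>2 * norm x\<close> times the identity,
  hence has norm at most \<open>2 * norm x\<close>; removing the shift costs another
  \<open>norm x\<close>.\<close>

lemma positive_unital_norm_selfadjoint:
  assumes x: "x \<in> B" "selfadjoint_op x"
  shows "norm (\<Phi> x) \<le> 3 * norm x"
proof -
  let ?T = "norm x *\<^sub>R id_blinfun + \<Phi> x"
  have "Re (cinner (?T y) y) \<le> (2 * norm x) * (norm y)\<^sup>2" for y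
    using positive_unital_shift(2) [OF x] unfolding positive_op_iff
    by (auto simp: blinfun.add_left blinfun.diff_left blinfun.scaleR_left cinner.add_left cinner.diff_left
          cinner.scaleR_left Re_cinner_self dest: spec [of _ y])
  then have "norm (?T y) \<le> (2 * norm x) * norm y" for y
    using positive_unital_shift(1) [OF x] by (intro positive_op_norm_le) auto
  then have "norm ?T \<le> 2 * norm x"
    by (intro norm_blinfun_bound) auto
  moreover have "norm (norm x *\<^sub>R (id_blinfun :: 'h \<Rightarrow>\<^sub>L 'h)) \<le> norm x"
    by (rule norm_blinfun_bound) (auto simp: blinfun.scaleR_left)
  moreover have "norm (\<Phi> x) \<le> norm ?T + norm (norm x *\<^sub>R (id_blinfun :: 'h \<Rightarrow>\<^sub>L 'h))"
    using norm_triangle_ineq4 [of ?T "norm x *\<^sub>R (id_blinfun :: 'h \<Rightarrow>\<^sub>L 'h)"] by simp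
  ultimately show ?thesis
    by linarith
qed

text \<open>The constant is not optimal; splitting into self-adjoint parts avoids the Kadison--Schwarz
  inequality.\<close>

lemma positive_unital_norm_le:
  assumes x: "x \<in> B"
  shows "norm (\<Phi> x) \<le> 6 * norm x"
proof -
  note bd = vna_bounded [OF B x]
  define h where "h = (1/2) *\<^sub>C (x + adjoint_op x)"
  define k where "k = (-\<i>/2) *\<^sub>C (x - adjoint_op x)"
  have mem: "h \<in> B" "k \<in> B"
    using x by (auto simp: h_def k_def intro!: vna_scaleC [OF B] vna_add [OF B] vna_diff [OF B] vna_adjoint [OF B])
  have sa: "selfadjoint_op h" "selfadjoint_op k"
    using mem vna_bounded [OF B]
    by (auto intro!: selfadjoint_opI simp: h_def k_def scaleC_blinfun.rep_eq cinner_scaleC_left cinner_scaleC_right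
        blinfun.add_left blinfun.diff_left cinner.add_left cinner.add_right cinner.diff_left cinner.diff_right
        cinner_adjoint [OF bd] cinner_adjoint' [OF bd] algebra_simps)
  have xhk: "x = h + \<i> *\<^sub>C k"
  proof (rule blinfun_eqI)
    fix y
    have "(1/2) *\<^sub>C x y + (1/2) *\<^sub>C x y = x y"
      by (simp flip: scaleC_add_left)
    then show "x y = (h + \<i> *\<^sub>C k) y"
      by (simp add: h_def k_def scaleC_blinfun.rep_eq blinfun.add_left blinfun.diff_left scaleC_add_right
          scaleC_diff_right scaleC_scaleC)
  qed
  have adj: "norm (adjoint_op x) \<le> norm x"
    by (rule norm_adjoint_le [OF bd])
  have "norm h \<le> norm x"
    using norm_scaleC_blinfun_le [of "1/2" "x + adjoint_op x"] norm_triangle_ineq [of x "adjoint_op x"] adj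
    by (simp add: h_def)
  moreover have "norm k \<le> norm x"
    using norm_scaleC_blinfun_le [of "-\<i>/2" "x - adjoint_op x"] norm_triangle_ineq4 [of x "adjoint_op x"] adj
    by (simp add: k_def norm_divide)
  moreover have "\<Phi> x = \<Phi> h + \<i> *\<^sub>C \<Phi> k"
    by (subst xhk) (simp add: add scale mem vna_scaleC [OF B])
  then have "norm (\<Phi> x) \<le> norm (\<Phi> h) + norm (\<Phi> k)"
    using norm_triangle_ineq [of "\<Phi> h" "\<i> *\<^sub>C \<Phi> k"] norm_scaleC_blinfun_le [of \<i> "\<Phi> k"] by simp
  ultimately show ?thesis
    using positive_unital_norm_selfadjoint [OF mem(1) sa(1)] positive_unital_norm_selfadjoint [OF mem(2) sa(2)]
    by linarith
qed

end

section \<open>Time partitions\<close>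

lemma directed_time_partitions: "directed_by time_partitions (\<subseteq>)"
  unfolding directed_by_def
proof (intro conjI ballI)
  show "time_partitions \<noteq> {}"
    by (auto simp: time_partitions_def intro!: exI [of _ "{0, \<infinity>}"])
  show "\<exists>\<theta>\<in>time_partitions. \<theta>1 \<subseteq> \<theta> \<and> \<theta>2 \<subseteq> \<theta>"
    if "\<theta>1 \<in> time_partitions" "\<theta>2 \<in> time_partitions" for \<theta>1 \<theta>2
    using that by (intro bexI [of _ "\<theta>1 \<union> \<theta>2"]) (auto simp: time_partitions_def)
qed (auto intro: transpI)

lemma partitions_at_top_eq: "partitions_at_top = net_at_top time_partitions (\<subseteq>)"
  by (simp add: partitions_at_top_def net_at_top_def)

text \<open>A refinement is reached by inserting finitely many points, so statements about
  refinements reduce to the insertion of one point.\<close>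

lemma time_partition_induct:
  assumes "\<theta> \<in> time_partitions" "\<theta>' \<in> time_partitions" "\<theta> \<subseteq> \<theta>'" and base: "P \<theta>"
    and step: "\<And>\<eta> s. \<eta> \<in> time_partitions \<Longrightarrow> s \<notin> \<eta> \<Longrightarrow> P \<eta> \<Longrightarrow> P (insert s \<eta>)"
  shows "P \<theta>'"
proof -
  have "finite D \<Longrightarrow> P (\<theta> \<union> D)" for D
  proof (induction D rule: finite_induct)
    case (insert s D)
    have "\<theta> \<union> D \<in> time_partitions"
      using insert assms(1) by (auto simp: time_partitions_def)
    then show ?case
      using insert step [of "\<theta> \<union> D" s] by (cases "s \<in> \<theta> \<union> D") (auto simp: insert_absorb)
  qed (use base in simp)
  moreover have "finite \<theta>'"
    using assms(2) by (simp add: time_partitions_def)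
  ultimately have "P (\<theta> \<union> \<theta>')"
    by blast
  then show ?thesis
    using assms(3) by (simp add: Un_absorb1)
qed

text \<open>A Riemann-Stieltjes sum of \<open>f\<close> against the increments of \<open>q\<close>,
  with \<open>f\<close> taken at the right end of each interval. Taking \<open>f\<close> to be the
  projections \<open>P\<close> gives the partition projections; the operators \<open>E t x\<close>
  give their counterpart on the algebra; a constant \<open>f\<close> telescopes.\<close>

definition partition_sum ::
  "(ennreal \<Rightarrow> 'h \<Rightarrow>\<^sub>L 'h) \<Rightarrow> (ennreal \<Rightarrow> 'h::real_normed_vector \<Rightarrow>\<^sub>L 'h) \<Rightarrow> ennreal set \<Rightarrow> 'h \<Rightarrow>\<^sub>L 'h" where
  "partition_sum q f \<theta> = (\<Sum>t\<in>\<theta> - {0}. (q t - q (Max {s \<in> \<theta>. s < t})) o\<^sub>L f t)"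

text \<open>The point \<open>s\<close> splits the interval from \<open>p\<close> to \<open>u\<close>
  between its neighbours in \<open>\<theta>\<close>. On the part from \<open>p\<close> to
  \<open>s\<close> the value \<open>f u\<close> is replaced by \<open>f s\<close>, and no other term
  changes.\<close>

lemma partition_sum_insert:
  assumes \<theta>: "\<theta> \<in> time_partitions" and s: "s \<notin> \<theta>"
  shows "\<exists>p u. p < s \<and> s < u \<and>
    partition_sum q f \<theta> = partition_sum q f (insert s \<theta>) + ((q s - q p) o\<^sub>L (f u - f s))"
proof -
  have fin: "finite \<theta>" and 0: "0 \<in> \<theta>" and \<infinity>: "\<infinity> \<in> \<theta>"
    using \<theta> by (auto simp: time_partitions_def)
  have s0: "0 < s" "s < \<infinity>"
    using s 0 \<infinity> by (metis gr_zeroI, metis infinity_ennreal_def less_top)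
  define u where "u = Min {t \<in> \<theta>. s < t}"
  define p where "p = Max {t \<in> \<theta>. t < s}"
  have "u \<in> {t \<in> \<theta>. s < t}"
    unfolding u_def using fin \<infinity> s0 by (intro Min_in) auto
  then have u: "u \<in> \<theta>" "s < u"
    by auto
  have u_le: "u \<le> t" if "t \<in> \<theta>" "s < t" for t
    unfolding u_def using that fin by (intro Min_le) auto
  have "p \<in> {t \<in> \<theta>. t < s}"
    unfolding p_def using fin 0 s0 by (intro Max_in) auto
  then have p: "p < s"
    by auto
  \<comment> \<open>No point of \<open>\<theta>\<close> lies between \<open>s\<close> and
    \<open>u\<close>, so the predecessor of \<open>u\<close> in \<open>\<theta>\<close> is the
    \<open>p\<close> defined from \<open>s\<close>.\<close>
  have below: "{r \<in> \<theta>. r < u} = {r \<in> \<theta>. r < s}"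
    using u u_le s by (auto simp: not_less dest: leD) (metis leD linorder_neqE)
  define R where "R = \<theta> - {0} - {u}"
  have pred: "Max {r \<in> insert s \<theta>. r < t} = Max {r \<in> \<theta>. r < t}" if "t \<in> R" for t
  proof (cases "t < s")
    case True
    then have "{r \<in> insert s \<theta>. r < t} = {r \<in> \<theta>. r < t}"
      by auto
    then show ?thesis
      by simp
  next
    case False
    then have st: "s < t"
      using that s by (metis DiffD1 R_def linorder_neqE)
    then have ut: "u < t"
      using that u_le [of t] by (auto simp: R_def)
    have "{r \<in> insert s \<theta>. r < t} = insert s {r \<in> \<theta>. r < t}"
      using st by auto
    moreover have "u \<le> Max {r \<in> \<theta>. r < t}"
      using fin u ut by (intro Max_ge) auto
    moreover have "{r \<in> \<theta>. r < t} \<noteq> {}"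
      using u ut by auto
    ultimately show ?thesis
      using fin less_imp_le [OF u(2)] by (simp add: max_absorb2 order_trans [of s u])
  qed
  have pred_u: "Max {r \<in> insert s \<theta>. r < u} = s"
  proof (rule Max_eqI)
    show "finite {r \<in> insert s \<theta>. r < u}" "s \<in> {r \<in> insert s \<theta>. r < u}"
      using fin u by auto
    fix r assume "r \<in> {r \<in> insert s \<theta>. r < u}"
    then have "r = s \<or> r \<in> {r \<in> \<theta>. r < s}"
      unfolding below [symmetric] by blast
    then show "r \<le> s"
      by auto
  qed
  have pred_s: "Max {r \<in> insert s \<theta>. r < s} = p"
    unfolding p_def by (rule arg_cong [of _ _ Max]) auto
  have pred_u': "Max {r \<in> \<theta>. r < u} = p"
    by (simp add: below p_def)
  have Rs: "s \<notin> insert u R" "u \<notin> R" "finite R"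
    using s u fin by (auto simp: R_def)
  have set: "\<theta> - {0} = insert u R" "insert s \<theta> - {0} = insert s (insert u R)"
    using u s0 by (auto simp: R_def)
  have "partition_sum q f (insert s \<theta>) =
      ((q s - q p) o\<^sub>L f s) + (((q u - q s) o\<^sub>L f u) + (\<Sum>t\<in>R. (q t - q (Max {s \<in> \<theta>. s < t})) o\<^sub>L f t))"
  proof -
    have "(\<Sum>t\<in>R. (q t - q (Max {r \<in> insert s \<theta>. r < t})) o\<^sub>L f t) =
        (\<Sum>t\<in>R. (q t - q (Max {r \<in> \<theta>. r < t})) o\<^sub>L f t)"
      by (rule sum.cong) (simp_all only: pred)
    then show ?thesis
      unfolding partition_sum_def set using Rs
      by (simp only: sum.insert finite_insert pred_u pred_s not_False_eq_True)
  qed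
  moreover have "partition_sum q f \<theta> =
      ((q u - q p) o\<^sub>L f u) + (\<Sum>t\<in>R. (q t - q (Max {s \<in> \<theta>. s < t})) o\<^sub>L f t)"
    unfolding partition_sum_def set using Rs by (simp add: pred_u')
  ultimately have "partition_sum q f \<theta> = partition_sum q f (insert s \<theta>) + ((q s - q p) o\<^sub>L (f u - f s))"
    by (intro blinfun_eqI) (simp add: blinfun.add_left blinfun.diff_left blinfun.diff_right)
  then show ?thesis
    using p u by blast
qed

text \<open>On the coarsest partition the sum is \<open>a\<close> because \<open>q\<close> rises
  from 0 to the identity; for constant \<open>f\<close> the correction term of an insertion
  vanishes.\<close>

lemma partition_sum_const:
  assumes \<theta>: "\<theta> \<in> time_partitions" and q: "q 0 = 0" "q \<infinity> = id_blinfun"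
  shows "partition_sum q (\<lambda>_. a) \<theta> = a"
proof (rule time_partition_induct [OF _ \<theta>])
  show "{0, \<infinity>} \<in> time_partitions" "{0, \<infinity>} \<subseteq> \<theta>"
    using \<theta> by (auto simp: time_partitions_def)
  have "{0, \<infinity>} - {0} = {\<infinity> :: ennreal}" "{s \<in> {0, \<infinity>}. s < (\<infinity> :: ennreal)} = {0}"
    by auto
  then show "partition_sum q (\<lambda>_. a) {0, \<infinity>} = a"
    unfolding partition_sum_def using q by (intro blinfun_eqI) simp
next
  fix \<eta> s assume \<eta>: "\<eta> \<in> time_partitions" "s \<notin> \<eta>" "partition_sum q (\<lambda>_. a) \<eta> = a"
  obtain p where "partition_sum q (\<lambda>_. a) \<eta> = partition_sum q (\<lambda>_. a) (insert s \<eta>) + ((q s - q p) o\<^sub>L (a - a))"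
    using partition_sum_insert [OF \<eta>(1,2)] by blast
  moreover have "(q s - q p) o\<^sub>L (a - a) = 0"
    by (intro blinfun_eqI) simp
  ultimately show "partition_sum q (\<lambda>_. a) (insert s \<eta>) = a"
    using \<eta>(3) by simp
qed

text \<open>The directed family has a strong limit \<open>T\<close> in \<open>B\<close>. It is an
  upper bound, so \<open>s\<close> is below \<open>T\<close>; each member is below \<open>s\<close>,
  so \<open>T\<close> is below \<open>s\<close>; antisymmetry identifies them.\<close>

lemma op_sup_strong_limit:
  fixes D :: "('h::complex_hilbert \<Rightarrow>\<^sub>L 'h) set"
  assumes B: "von_neumann_algebra B" and D: "D \<subseteq> B" "D \<noteq> {}" "\<forall>d\<in>D. selfadjoint_op d"
    and dir: "\<forall>d\<in>D. \<forall>e\<in>D. \<exists>f\<in>D. op_le d f \<and> op_le e f" and sup: "is_op_sup B D s"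
  shows "directed_by D op_le" and "((\<lambda>d. blinfun_apply d x) \<longlongrightarrow> s x) (net_at_top D op_le)"
proof -
  show dirD: "directed_by D op_le"
    using D dir unfolding directed_by_def by (auto intro: transpI op_le_trans)
  note nb = net_at_top_not_bot [OF dirD]
  have s: "s \<in> B" "selfadjoint_op s" "\<And>d. d \<in> D \<Longrightarrow> op_le d s"
    using sup by (auto simp: is_op_sup_def)
  obtain T where T: "T \<in> bounded_ops" "\<And>x. ((\<lambda>d. blinfun_apply d x) \<longlongrightarrow> T x) (net_at_top D op_le)"
    using increasing_net_strong_limit [OF dirD, of "\<lambda>d. d" s] D s by auto
  have evD: "eventually (\<lambda>d. d \<in> D) (net_at_top D op_le)"
    using D by (auto simp: eventually_net_at_top [OF dirD])
  have form: "((\<lambda>d. Re (cinner (blinfun_apply d x) x)) \<longlongrightarrow> Re (cinner (T x) x)) (net_at_top D op_le)" for x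
    by (intro tendsto_Re cinner.tendsto T tendsto_const)
  have "T \<in> B"
    using eventually_mono [OF evD, of "\<lambda>d. d \<in> B"] D by (intro vna_strong_limit [OF B nb _ T]) auto
  moreover have sa: "selfadjoint_op T"
  proof (rule selfadjoint_opI [OF T(1)])
    fix x y
    have lim1: "((\<lambda>d. cinner (blinfun_apply d x) y) \<longlongrightarrow> cinner (T x) y) (net_at_top D op_le)"
      by (intro cinner.tendsto T tendsto_const)
    have lim2: "((\<lambda>d. cinner x (blinfun_apply d y)) \<longlongrightarrow> cinner x (T y)) (net_at_top D op_le)"
      by (intro cinner.tendsto T tendsto_const)
    have ev: "eventually (\<lambda>d. cinner x (blinfun_apply d y) = cinner (d x) y) (net_at_top D op_le)"
      using evD by eventually_elim (use D in \<open>simp add: selfadjoint_opD\<close>)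
    show "cinner (T x) y = cinner x (T y)"
      by (rule tendsto_unique [OF nb lim1 Lim_transform_eventually [OF lim2 ev]])
  qed
  moreover have "op_le d T" if d: "d \<in> D" for d
  proof -
    have "Re (cinner (d x) x) \<le> Re (cinner (T x) x)" for x
    proof (rule tendsto_lowerbound [OF form _ nb])
      show "eventually (\<lambda>j. Re (cinner (d x) x) \<le> Re (cinner (blinfun_apply j x) x)) (net_at_top D op_le)"
        by (rule eventually_net_at_topI [OF dirD d]) (use D d in \<open>simp add: op_le_iff\<close>)
    qed
    then show ?thesis
      using sa D d by (simp add: op_le_iff)
  qed
  ultimately have "op_le s T"
    using sup by (auto simp: is_op_sup_def)
  moreover have "op_le T s"
  proof -
    have "Re (cinner (T x) x) \<le> Re (cinner (s x) x)" for x
    proof (rule tendsto_upperbound [OF form _ nb])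
      show "eventually (\<lambda>d. Re (cinner (blinfun_apply d x) x) \<le> Re (cinner (s x) x)) (net_at_top D op_le)"
        using evD by eventually_elim (use s D op_le_iff in blast)
    qed
    then show ?thesis
      using sa s by (simp add: op_le_iff)
  qed
  ultimately have "s = T"
    by (rule op_le_antisym)
  then show "((\<lambda>d. blinfun_apply d x) \<longlongrightarrow> s x) (net_at_top D op_le)"
    using T by simp
qed

lemma blinfun_compose_id [simp]: "a o\<^sub>L id_blinfun = a" "id_blinfun o\<^sub>L a = a"
  by (auto intro: blinfun_eqI)

section \<open>The time projection\<close>

text \<open>Conditional expectations are assumed for all \<open>t\<close>, including the final time,
  so that the last term of a partition sum is treated like the others.\<close>

locale stopped_filtration =
  fixes A :: "('h::complex_hilbert \<Rightarrow>\<^sub>L 'h) set"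
    and \<Omega> :: 'h
    and F :: "ennreal \<Rightarrow> ('h \<Rightarrow>\<^sub>L 'h) set"
    and E :: "ennreal \<Rightarrow> 'h \<Rightarrow>\<^sub>L 'h \<Rightarrow> 'h \<Rightarrow>\<^sub>L 'h"
    and q :: "ennreal \<Rightarrow> 'h \<Rightarrow>\<^sub>L 'h"
  assumes A: "von_neumann_algebra A"
    and separating: "separating_vector A \<Omega>"
    and F_mono: "s \<le> t \<Longrightarrow> F s \<subseteq> F t"
    and F_infinity: "F \<infinity> = A"
    and cond_exp: "conditional_expectation A (F t) (E t)"
    and state: "x \<in> A \<Longrightarrow> vector_state \<Omega> (E t x) = vector_state \<Omega> x"
    and stopping: "stopping_time F q"
begin

lemma F_vna: "von_neumann_algebra (F t)"
  and F_subset: "b \<in> F t \<Longrightarrow> b \<in> A"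
  and E_mem: "x \<in> A \<Longrightarrow> E t x \<in> F t"
  and E_add: "x \<in> A \<Longrightarrow> y \<in> A \<Longrightarrow> E t (x + y) = E t x + E t y"
  and E_scaleC: "x \<in> A \<Longrightarrow> E t (c *\<^sub>C x) = c *\<^sub>C E t x"
  and E_positive: "x \<in> A \<Longrightarrow> positive_op x \<Longrightarrow> positive_op (E t x)"
  and E_fixes: "b \<in> F t \<Longrightarrow> E t b = b"
  and E_bimodule: "x \<in> A \<Longrightarrow> b \<in> F t \<Longrightarrow> d \<in> F t \<Longrightarrow> E t (b o\<^sub>L x o\<^sub>L d) = b o\<^sub>L E t x o\<^sub>L d"
  using cond_exp [of t] by (auto simp: conditional_expectation_def)

lemma E_left: "x \<in> A \<Longrightarrow> b \<in> F t \<Longrightarrow> E t (b o\<^sub>L x) = b o\<^sub>L E t x"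
  using E_bimodule [of x b t id_blinfun] vna_id [OF F_vna] by simp

lemma E_right: "x \<in> A \<Longrightarrow> c \<in> F t \<Longrightarrow> E t (x o\<^sub>L c) = E t x o\<^sub>L c"
  using E_bimodule [of x id_blinfun t c] vna_id [OF F_vna] by simp

lemma q_projection: "projection_op (q t)"
  and q_mem: "q t \<in> F t"
  and q_le: "s \<le> t \<Longrightarrow> op_le (q s) (q t)"
  and q_0: "q 0 = 0"
  and q_infinity: "q \<infinity> = id_blinfun"
  using stopping by (auto simp: stopping_time_def)

lemma q_mem': "s \<le> t \<Longrightarrow> q s \<in> F t"
  using q_mem F_mono by blast

lemma q_absorb: "s \<le> t \<Longrightarrow> q t (q s x) = q s x" "s \<le> t \<Longrightarrow> q s (q t x) = q s x"
  using projection_op_le_absorb [OF q_projection q_projection q_le] by auto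

abbreviation "P t \<equiv> filtration_projection F \<Omega> t"

lemma csubspace_F: "csubspace (closure ((\<lambda>a. blinfun_apply a \<Omega>) ` F t))"
  by (intro csubspace_closure csubspace_orbit F_vna)

lemma P_projection: "projection_op (P t)"
  and P_range: "range (blinfun_apply (P t)) = closure ((\<lambda>a. blinfun_apply a \<Omega>) ` F t)"
  using projection_onto [OF csubspace_F] by (auto simp: filtration_projection_def)

lemma P_commutes: "b \<in> F t \<Longrightarrow> P t (b x) = b (P t x)"
  unfolding filtration_projection_def by (rule orbit_projection_commutes [OF F_vna])

lemma P_absorb: "s \<le> t \<Longrightarrow> P t (P s x) = P s x"
  by (rule projection_op_range_subset_absorb [OF P_projection])
    (simp add: P_range closure_mono image_mono F_mono)

text \<open>For \<open>b\<close> in \<open>F t\<close>, invariance of the state and the module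
  property make the pairings of \<open>x \<Omega>\<close> and \<open>E t x \<Omega>\<close> with
  \<open>b \<Omega>\<close> agree. So the difference is orthogonal to the orbit of
  \<open>F t\<close>, and by continuity to its closure.\<close>

lemma P_orbit:
  assumes x: "x \<in> A"
  shows "P t (x \<Omega>) = E t x \<Omega>"
  unfolding filtration_projection_def
proof (rule projection_onto_apply_eqI [OF csubspace_F closed_closure])
  show "E t x \<Omega> \<in> closure ((\<lambda>a. blinfun_apply a \<Omega>) ` F t)"
    by (intro subsetD [OF closure_subset] imageI E_mem x)
  let ?v = "x \<Omega> - E t x \<Omega>"
  have "(\<lambda>a. blinfun_apply a \<Omega>) ` F t \<subseteq> {s. cinner ?v s = 0}"
  proof clarsimp
    fix b assume b: "b \<in> F t"
    then have b': "adjoint_op b \<in> F t"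
      by (rule vna_adjoint [OF F_vna])
    have "cinner ?v (b \<Omega>) = vector_state \<Omega> (adjoint_op b o\<^sub>L x) - vector_state \<Omega> (adjoint_op b o\<^sub>L E t x)"
      by (simp add: vector_state_def cinner.diff_left cinner_adjoint' vna_bounded [OF F_vna b])
    also have "\<dots> = 0"
      using state [of "adjoint_op b o\<^sub>L x" t] x F_subset [OF b'] by (simp add: E_left b' vna_compose [OF A])
    finally show "cinner ?v (b \<Omega>) = 0" .
  qed
  moreover have "closed {s. cinner ?v s = 0}"
    by (intro closed_Collect_eq continuous_intros linear_continuous_on cinner.bounded_linear_right)
  ultimately show "cinner ?v s = 0" if "s \<in> closure ((\<lambda>a. blinfun_apply a \<Omega>) ` F t)" for s
    using that closure_minimal by blast
qed

section \<open>Increments of the stopping time along a partition\<close>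

definition increment :: "ennreal set \<Rightarrow> ennreal \<Rightarrow> 'h \<Rightarrow>\<^sub>L 'h" where
  "increment \<theta> t = q t - q (Max {s \<in> \<theta>. s < t})"

lemma previous_point:
  assumes "\<theta> \<in> time_partitions" "t \<in> \<theta> - {0}"
  shows "Max {s \<in> \<theta>. s < t} < t" and "r \<in> \<theta> \<Longrightarrow> r < t \<Longrightarrow> r \<le> Max {s \<in> \<theta>. s < t}"
proof -
  have fin: "finite {s \<in> \<theta>. s < t}" "0 \<in> {s \<in> \<theta>. s < t}"
    using assms by (auto simp: time_partitions_def zero_less_iff_neq_zero)
  then show "Max {s \<in> \<theta>. s < t} < t"
    using Max_in [of "{s \<in> \<theta>. s < t}"] by blast
  show "r \<in> \<theta> \<Longrightarrow> r < t \<Longrightarrow> r \<le> Max {s \<in> \<theta>. s < t}"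
    using fin by (intro Max_ge) auto
qed

lemma q_increment_projection: "s \<le> t \<Longrightarrow> projection_op (q t - q s)"
  by (intro projection_op_diff q_projection q_absorb)

context
  fixes \<theta> t
  assumes \<theta>: "\<theta> \<in> time_partitions" and t: "t \<in> \<theta> - {0}"
begin

lemma increment_projection: "projection_op (increment \<theta> t)"
  unfolding increment_def using previous_point(1) [OF \<theta> t] by (intro q_increment_projection) simp

lemma increment_mem: "increment \<theta> t \<in> F t"
  unfolding increment_def using previous_point(1) [OF \<theta> t]
  by (intro vna_diff [OF F_vna] q_mem' q_mem) simp

lemma increment_before:
  assumes "t \<le> s"
  shows "q s (increment \<theta> t x) = increment \<theta> t x" "increment \<theta> t (q s x) = increment \<theta> t x"
  using assms less_imp_le [OF less_le_trans [OF previous_point(1) [OF \<theta> t] assms]]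
  by (simp_all only: increment_def blinfun.diff_left blinfun.diff_right q_absorb)

text \<open>A point \<open>s\<close> of \<open>\<theta>\<close> before \<open>t\<close> is at most
  the predecessor of \<open>t\<close>. Both projections in the increment therefore absorb
  \<open>q s\<close>, and the two contributions cancel.\<close>

lemma increment_after:
  assumes "s \<in> \<theta>" "s < t"
  shows "q s (increment \<theta> t x) = 0" "increment \<theta> t (q s x) = 0"
  using less_imp_le [OF assms(2)] previous_point(2) [OF \<theta> t assms]
  by (simp_all only: increment_def blinfun.diff_left blinfun.diff_right q_absorb diff_self)

end

section \<open>Monotone convergence of the partition projections\<close>

abbreviation "M \<theta> \<equiv> partition_projection F \<Omega> q \<theta>"

lemma M_eq: "M \<theta> = partition_sum q P \<theta>"
  by (simp add: partition_projection_def partition_sum_def)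

lemma M_positive: "\<theta> \<in> time_partitions \<Longrightarrow> positive_op (M \<theta>)"
  unfolding partition_projection_def increment_def [symmetric]
  by (intro positive_op_sum projection_op_positive projection_op_compose increment_projection P_projection
      P_commutes increment_mem)

text \<open>Inserting a point subtracts \<open>(q s - q p) o\<^sub>L (P u - P s)\<close>, a product
  of commuting projections and hence positive.\<close>

lemma M_antimono:
  assumes "\<theta> \<in> time_partitions" "\<theta>' \<in> time_partitions" "\<theta> \<subseteq> \<theta>'"
  shows "op_le (M \<theta>') (M \<theta>)"
proof (rule time_partition_induct [OF assms])
  show "op_le (M \<theta>) (M \<theta>)"
    by (rule op_le_refl)
next
  fix \<eta> s assume \<eta>: "\<eta> \<in> time_partitions" "s \<notin> \<eta>" and le: "op_le (M \<eta>) (M \<theta>)"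
  obtain p u where pu: "p < s" "s < u"
    and eq: "M \<eta> = M (insert s \<eta>) + ((q s - q p) o\<^sub>L (P u - P s))"
    unfolding M_eq using partition_sum_insert [OF \<eta>, of q P] by blast
  have "projection_op ((q s - q p) o\<^sub>L (P u - P s))"
  proof (rule projection_op_compose)
    show "projection_op (q s - q p)"
      using pu by (intro q_increment_projection) simp
    show "projection_op (P u - P s)"
      using pu by (intro projection_op_diff P_projection P_absorb) simp
    \<comment> \<open>Membership in both algebras makes this increment commute with
      \<open>P s\<close> and with \<open>P u\<close>.\<close>
    have "q s - q p \<in> F s" "q s - q p \<in> F u"
      using pu by (auto intro!: vna_diff [OF F_vna] q_mem')
    then show "(P u - P s) ((q s - q p) x) = (q s - q p) ((P u - P s) x)" for x
      by (simp add: blinfun.diff_left [of "P u"] blinfun.diff_right [of "q s - q p"] P_commutes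
          del: minus_blinfun.rep_eq)
  qed
  then have "op_le (M (insert s \<eta>)) (M \<eta>)"
    by (simp add: op_le_def eq projection_op_positive)
  then show "op_le (M (insert s \<eta>)) (M \<theta>)"
    using le by (rule op_le_trans)
qed

lemma partitions_not_bot: "partitions_at_top \<noteq> bot"
  by (simp add: partitions_at_top_eq net_at_top_not_bot directed_time_partitions)

lemma eventually_partition:
  "eventually (\<lambda>\<theta>. \<theta> \<in> time_partitions \<and> t \<in> \<theta>) partitions_at_top"
  unfolding partitions_at_top_eq
  by (rule eventually_net_at_topI [OF directed_time_partitions, of "{0, \<infinity>, t}"])
    (auto simp: time_partitions_def)

text \<open>The negated net increases and is bounded above by 0. Uniqueness of limits shows that the
  definite description in \<open>time_projection\<close> denotes the limit.\<close>

lemma M_limit: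
  "time_projection F \<Omega> q \<in> bounded_ops"
  "((\<lambda>\<theta>. M \<theta> x) \<longlongrightarrow> time_projection F \<Omega> q x) partitions_at_top"
proof -
  have sa: "selfadjoint_op (- M \<theta>)" if "\<theta> \<in> time_partitions" for \<theta>
    using selfadjoint_op_scaleR [OF positive_op_selfadjoint [OF M_positive [OF that]], of "- 1"] by simp
  have sa0: "selfadjoint_op (0 :: 'h \<Rightarrow>\<^sub>L 'h)"
    by (rule positive_op_selfadjoint [OF positive_op_zero])
  obtain T where T: "T \<in> bounded_ops" "\<And>x. ((\<lambda>\<theta>. (- M \<theta>) x) \<longlongrightarrow> T x) partitions_at_top"
    using increasing_net_strong_limit [OF directed_time_partitions, of "\<lambda>\<theta>. - M \<theta>" 0] sa sa0 M_antimono M_positive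
    unfolding partitions_at_top_eq by (auto simp: op_le_def)
  have lim: "((\<lambda>\<theta>. M \<theta> x) \<longlongrightarrow> (- T) x) partitions_at_top" for x
    using tendsto_minus [OF T(2) [of x]] by (simp add: blinfun.minus_left)
  have "time_projection F \<Omega> q = - T"
    unfolding time_projection_def
  proof (rule the_equality)
    fix N :: "'h \<Rightarrow>\<^sub>L 'h"
    assume "\<forall>x. ((\<lambda>\<theta>. M \<theta> x) \<longlongrightarrow> N x) partitions_at_top"
    then show "N = - T"
      using tendsto_unique [OF partitions_not_bot _ lim] by (intro blinfun_eqI) blast
  qed (use lim in blast)
  moreover have "- T \<in> bounded_ops"
    using bounded_ops_scaleR [OF T(1), of "- 1"] by simp
  ultimately show "time_projection F \<Omega> q \<in> bounded_ops"
    "((\<lambda>\<theta>. M \<theta> x) \<longlongrightarrow> time_projection F \<Omega> q x) partitions_at_top"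
    using lim by auto
qed

section \<open>The algebras of the stopping time\<close>

abbreviation "B \<equiv> B_tau A q"
abbreviation "A\<^sub>\<tau> \<equiv> A_tau A F q"

lemma B_D:
  assumes "x \<in> B"
  shows "x \<in> A" and "x (q t \<xi>) = q t (x \<xi>)"
proof -
  show "x \<in> A"
    using assms by (simp add: B_tau_def)
  show "x (q t \<xi>) = q t (x \<xi>)"
  proof (cases "t < \<infinity>")
    case True
    then have "x o\<^sub>L q t = q t o\<^sub>L x"
      using assms by (simp add: B_tau_def)
    then show ?thesis
      by (metis blinfun_apply_blinfun_compose)
  next
    case False
    then have "t = \<infinity>"
      by (simp add: not_less top_unique)
    then show ?thesis
      by (simp add: q_infinity del: infinity_ennreal_def)
  qed
qed

text \<open>By the double commutant property, membership in \<open>A\<close> is itself a commutation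
  condition, so all conditions defining \<open>B\<close> combine into one commutant.\<close>

lemma B_eq: "B = commutant (commutant A \<union> q ` {..<\<infinity>})"
proof -
  have "x \<in> A \<longleftrightarrow> x \<in> bounded_ops \<and> (\<forall>a\<in>commutant A. a o\<^sub>L x = x o\<^sub>L a)" for x
    by (subst vna_double_commutant [OF A, symmetric]) (simp add: commutant_def)
  then have "x \<in> B \<longleftrightarrow> x \<in> bounded_ops \<and> (\<forall>a\<in>commutant A. a o\<^sub>L x = x o\<^sub>L a) \<and>
      (\<forall>t<\<infinity>. q t o\<^sub>L x = x o\<^sub>L q t)" for x
    unfolding B_tau_def mem_Collect_eq by metis
  then show ?thesis
    unfolding commutant_def [of "_ \<union> _"] by blast
qed

lemma B_vna: "von_neumann_algebra B"
  unfolding B_eq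
proof (rule von_neumann_algebra_commutant)
  show "commutant A \<union> q ` {..<\<infinity>} \<subseteq> bounded_ops"
    using commutant_bounded q_projection by (auto simp: projection_op_bounded)
  show "adjoint_op a \<in> commutant A \<union> q ` {..<\<infinity>}" if "a \<in> commutant A \<union> q ` {..<\<infinity>}" for a
    using that vna_adjoint [OF vna_commutant [OF A]] projection_op_selfadjoint [OF q_projection]
    by (auto simp: selfadjoint_op_def)
qed

text \<open>Membership of \<open>q t o\<^sub>L x\<close> in \<open>F t\<close> means commutation
  with every \<open>b\<close> in the commutant. Both \<open>x\<close> and \<open>b\<close> commute
  with \<open>q t\<close>, the latter because \<open>q t\<close> belongs to \<open>F t\<close>, so
  \<open>q t\<close> can be moved from \<open>x\<close> to \<open>b\<close>.\<close>

lemma q_comp_mem_iff: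
  assumes x: "x \<in> bounded_ops" and comm: "x o\<^sub>L q t = q t o\<^sub>L x"
  shows "q t o\<^sub>L x \<in> F t \<longleftrightarrow> (\<forall>b\<in>commutant (F t). x o\<^sub>L (q t o\<^sub>L b) = (q t o\<^sub>L b) o\<^sub>L x)"
proof -
  have xq: "x (q t \<xi>) = q t (x \<xi>)" for \<xi>
    using comm by (metis blinfun_apply_blinfun_compose)
  have bq: "b (q t \<xi>) = q t (b \<xi>)" if "b \<in> commutant (F t)" for b \<xi>
    using that q_mem by (simp add: commutant_iff)
  have "q t o\<^sub>L x \<in> F t \<longleftrightarrow> q t o\<^sub>L x \<in> commutant (commutant (F t))"
    by (simp add: vna_double_commutant [OF F_vna])
  also have "\<dots> \<longleftrightarrow> (\<forall>b\<in>commutant (F t). \<forall>\<xi>. b (q t (x \<xi>)) = q t (x (b \<xi>)))"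
    using x projection_op_bounded [OF q_projection] by (simp add: commutant_iff [of "q t o\<^sub>L x"] bounded_ops_compose)
  also have "\<dots> \<longleftrightarrow> (\<forall>b\<in>commutant (F t). \<forall>\<xi>. x (q t (b \<xi>)) = q t (b (x \<xi>)))"
    by (rule ball_cong [OF refl]) (auto simp: bq xq)
  also have "\<dots> \<longleftrightarrow> (\<forall>b\<in>commutant (F t). x o\<^sub>L (q t o\<^sub>L b) = (q t o\<^sub>L b) o\<^sub>L x)"
    by (rule ball_cong [OF refl]) (metis (mono_tags) blinfun_apply_blinfun_compose blinfun_eqI)
  finally show ?thesis .
qed

text \<open>For \<open>x\<close> commuting with \<open>q\<^sub>t\<close>, membership of \<open>q\<^sub>t x\<close> in \<open>F t\<close> is the commutation of \<open>x\<close> with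
  all \<open>q\<^sub>t b\<close>, \<open>b\<close> in the commutant of \<open>F t\<close>. This exhibits \<open>A\<^sub>\<tau>\<close> as a commutant, hence as a
  von Neumann algebra.\<close>

definition A_tau_relations :: "('h \<Rightarrow>\<^sub>L 'h) set" where
  "A_tau_relations = commutant A \<union> {q t o\<^sub>L b | t b. t < \<infinity> \<and> b \<in> commutant (F t)}"

lemma A_tau_eq: "A\<^sub>\<tau> = commutant A_tau_relations"
proof -
  have 1: "x \<in> A \<longleftrightarrow> x \<in> bounded_ops \<and> (\<forall>a\<in>commutant A. a o\<^sub>L x = x o\<^sub>L a)" for x
    by (subst vna_double_commutant [OF A, symmetric]) (simp add: commutant_def)
  have 2: "x o\<^sub>L q t = q t o\<^sub>L x \<and> q t o\<^sub>L x \<in> F t \<longleftrightarrow> (\<forall>b\<in>commutant (F t). (q t o\<^sub>L b) o\<^sub>L x = x o\<^sub>L (q t o\<^sub>L b))"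
    if "x \<in> bounded_ops" for x t
  proof
    assume "\<forall>b\<in>commutant (F t). (q t o\<^sub>L b) o\<^sub>L x = x o\<^sub>L (q t o\<^sub>L b)"
    \<comment> \<open>The choice \<open>b = id_blinfun\<close> recovers commutation with
      \<open>q t\<close> itself.\<close>
    moreover from this have "x o\<^sub>L q t = q t o\<^sub>L x"
      using commutant_id [of "F t"] by force
    ultimately show "x o\<^sub>L q t = q t o\<^sub>L x \<and> q t o\<^sub>L x \<in> F t"
      using that by (simp add: q_comp_mem_iff)
  next
    assume *: "x o\<^sub>L q t = q t o\<^sub>L x \<and> q t o\<^sub>L x \<in> F t"
    show "\<forall>b\<in>commutant (F t). (q t o\<^sub>L b) o\<^sub>L x = x o\<^sub>L (q t o\<^sub>L b)"
      using q_comp_mem_iff [OF that, of t] * by metis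
  qed
  have "x \<in> A\<^sub>\<tau> \<longleftrightarrow> x \<in> bounded_ops \<and> (\<forall>a\<in>commutant A. a o\<^sub>L x = x o\<^sub>L a) \<and>
      (\<forall>t<\<infinity>. \<forall>b\<in>commutant (F t). (q t o\<^sub>L b) o\<^sub>L x = x o\<^sub>L (q t o\<^sub>L b))" for x
    unfolding A_tau_def mem_Collect_eq 1 by (metis 2)
  then show ?thesis
    unfolding A_tau_relations_def commutant_def [of "_ \<union> _"] by blast
qed

lemma A_tau_vna: "von_neumann_algebra A\<^sub>\<tau>"
  unfolding A_tau_eq
proof (rule von_neumann_algebra_commutant)
  show "A_tau_relations \<subseteq> bounded_ops"
    unfolding A_tau_relations_def using commutant_bounded projection_op_bounded [OF q_projection]
    by (auto intro!: bounded_ops_compose)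
  fix a assume "a \<in> A_tau_relations"
  then consider "a \<in> commutant A" | t b where "t < \<infinity>" "b \<in> commutant (F t)" "a = q t o\<^sub>L b"
    unfolding A_tau_relations_def by blast
  then show "adjoint_op a \<in> A_tau_relations"
  proof cases
    case 1
    then show ?thesis
      by (simp add: A_tau_relations_def vna_adjoint [OF vna_commutant [OF A]])
  next
    case 2
    have b': "adjoint_op b \<in> commutant (F t)"
      by (rule vna_adjoint [OF vna_commutant [OF F_vna] 2(2)])
    have "adjoint_op a = adjoint_op b o\<^sub>L q t"
      using subsetD [OF commutant_bounded 2(2)] projection_op_selfadjoint [OF q_projection [of t]]
      by (simp add: 2(3) adjoint_compose selfadjoint_op_def)
    also have "\<dots> = q t o\<^sub>L adjoint_op b"
      using b' q_mem [of t] by (auto simp: commutant_def)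
    finally show ?thesis
      using b' 2(1) unfolding A_tau_relations_def by blast
  qed
qed

lemma A_tau_subset_B: "b \<in> A\<^sub>\<tau> \<Longrightarrow> b \<in> B"
  by (simp add: A_tau_def B_tau_def)

lemma A_tau_q_mem:
  assumes "b \<in> A\<^sub>\<tau>"
  shows "q t o\<^sub>L b \<in> F t"
proof (cases "t < \<infinity>")
  case True
  then show ?thesis
    using assms by (simp add: A_tau_def)
next
  case False
  then have "t = \<infinity>"
    by (simp add: not_less top_unique)
  then show ?thesis
    using assms by (simp add: q_infinity F_infinity A_tau_def del: infinity_ennreal_def)
qed

section \<open>The conditional expectation of the stopping time\<close>

text \<open>This is the map written \<open>\<Phi>\<^sub>\<theta>\<close> in the opening
  outline.\<close>

definition partition_exp :: "ennreal set \<Rightarrow> 'h \<Rightarrow>\<^sub>L 'h \<Rightarrow> 'h \<Rightarrow>\<^sub>L 'h" where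
  "partition_exp \<theta> x = partition_sum q (\<lambda>t. E t x) \<theta>"

lemma partition_exp_eq: "partition_exp \<theta> x = (\<Sum>t\<in>\<theta> - {0}. increment \<theta> t o\<^sub>L E t x)"
  by (simp add: partition_exp_def partition_sum_def increment_def)

lemma partition_exp_apply: "partition_exp \<theta> x \<xi> = (\<Sum>t\<in>\<theta> - {0}. increment \<theta> t (E t x \<xi>))"
  by (simp add: partition_exp_eq blinfun.sum_left)

lemma partition_exp_orbit: "x \<in> A \<Longrightarrow> partition_exp \<theta> x \<Omega> = M \<theta> (x \<Omega>)"
  by (simp add: partition_exp_apply partition_projection_def increment_def blinfun.sum_left P_orbit)

text \<open>The module property moves \<open>b\<close> out of \<open>E t\<close> on either side, so
  \<open>E t x\<close> inherits commutation with \<open>b\<close> from \<open>x\<close>.\<close>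

lemma E_commutes:
  assumes x: "x \<in> B" and b: "b \<in> F t" and comm: "\<And>\<xi>. x (b \<xi>) = b (x \<xi>)"
  shows "E t x (b \<xi>) = b (E t x \<xi>)"
proof -
  have "x o\<^sub>L b = b o\<^sub>L x"
    by (rule blinfun_eqI) (simp add: comm)
  then have "E t x o\<^sub>L b = b o\<^sub>L E t x"
    using E_left [OF B_D(1) [OF x] b] E_right [OF B_D(1) [OF x] b] by simp
  then show ?thesis
    by (metis blinfun_apply_blinfun_compose)
qed

lemma B_increment: "x \<in> B \<Longrightarrow> x (increment \<theta> t \<xi>) = increment \<theta> t (x \<xi>)"
  by (simp add: increment_def blinfun.diff_left blinfun.diff_right B_D)

lemma E_increment:
  assumes "\<theta> \<in> time_partitions" "t \<in> \<theta> - {0}" "x \<in> B"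
  shows "E t x (increment \<theta> t \<xi>) = increment \<theta> t (E t x \<xi>)"
  by (rule E_commutes [OF assms(3) increment_mem [OF assms(1,2)] B_increment [OF assms(3)]])

lemma E_q: "s \<le> t \<Longrightarrow> x \<in> B \<Longrightarrow> E t x (q s \<xi>) = q s (E t x \<xi>)"
  by (intro E_commutes q_mem' B_D)

lemma partition_exp_mem: "\<theta> \<in> time_partitions \<Longrightarrow> x \<in> A \<Longrightarrow> partition_exp \<theta> x \<in> A"
  unfolding partition_exp_eq
  by (intro vna_sum [OF A] vna_compose [OF A] F_subset [OF increment_mem] F_subset [OF E_mem])

lemma partition_exp_add: "x \<in> A \<Longrightarrow> y \<in> A \<Longrightarrow> partition_exp \<theta> (x + y) = partition_exp \<theta> x + partition_exp \<theta> y"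
  by (rule blinfun_eqI) (simp add: partition_exp_apply E_add blinfun.add_left blinfun.add_right sum.distrib)

lemma increment_scaleC: "increment \<theta> t (c *\<^sub>C \<xi>) = c *\<^sub>C increment \<theta> t \<xi>"
  unfolding increment_def
  by (intro bounded_opsD bounded_ops_diff projection_op_bounded q_projection)

lemma scaleC_sum: "c *\<^sub>C (\<Sum>i\<in>I. f i) = (\<Sum>i\<in>I. c *\<^sub>C (f i :: 'h))"
  by (rule linear_sum [OF bounded_linear.linear [OF bounded_linear_scaleC]])

lemma partition_exp_scaleC: "x \<in> A \<Longrightarrow> partition_exp \<theta> (c *\<^sub>C x) = c *\<^sub>C partition_exp \<theta> x"
  by (rule blinfun_eqI)
    (simp add: partition_exp_apply E_scaleC scaleC_blinfun.rep_eq scaleC_sum increment_scaleC)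

lemma partition_exp_id: "\<theta> \<in> time_partitions \<Longrightarrow> partition_exp \<theta> id_blinfun = id_blinfun"
  unfolding partition_exp_def
  by (simp add: E_fixes vna_id [OF F_vna] partition_sum_const q_0 q_infinity del: infinity_ennreal_def)

text \<open>Each increment is a projection commuting with \<open>E t x\<close>, so every summand is
  the compression of a positive operator by that projection. The commutation is where membership in
  \<open>B\<close> enters.\<close>

lemma partition_exp_positive:
  assumes \<theta>: "\<theta> \<in> time_partitions" and x: "x \<in> B" "positive_op x"
  shows "positive_op (partition_exp \<theta> x)"
  unfolding partition_exp_eq
proof (rule positive_op_sum)
  fix t assume t: "t \<in> \<theta> - {0}"
  note d = increment_projection [OF \<theta> t]
  have E: "positive_op (E t x)"
    using x by (intro E_positive B_D)
  have "cinner ((increment \<theta> t o\<^sub>L E t x) \<xi>) \<xi> = cinner (E t x (increment \<theta> t \<xi>)) (increment \<theta> t \<xi>)" for \<xi>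
    using d x by (simp add: E_increment [OF \<theta> t] projection_op_idem
        flip: selfadjoint_opD [OF projection_op_selfadjoint [OF d]])
  then show "positive_op (increment \<theta> t o\<^sub>L E t x)"
    using E d by (simp add: positive_op_def bounded_ops_compose projection_op_bounded)
qed

lemma partition_exp_norm: "\<theta> \<in> time_partitions \<Longrightarrow> x \<in> B \<Longrightarrow> norm (partition_exp \<theta> x) \<le> 6 * norm x"
  by (rule positive_unital_norm_le [OF B_vna])
    (auto simp: partition_exp_add partition_exp_scaleC partition_exp_positive partition_exp_id B_D)

text \<open>Once \<open>t\<close> belongs to \<open>\<theta>\<close>, multiplication by
  \<open>q t\<close> keeps the terms up to time \<open>t\<close>, which lie in \<open>F t\<close>,
  and annihilates the later ones.\<close>

lemma partition_exp_q:
  assumes \<theta>: "\<theta> \<in> time_partitions" and t: "t \<in> \<theta>" and x: "x \<in> B"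
  shows "partition_exp \<theta> x (q t \<xi>) = q t (partition_exp \<theta> x \<xi>)" and "q t o\<^sub>L partition_exp \<theta> x \<in> F t"
proof -
  have "increment \<theta> s (E s x (q t \<xi>)) = q t (increment \<theta> s (E s x \<xi>))" if s: "s \<in> \<theta> - {0}" for s
  proof (cases "s \<le> t")
    case True
    have "increment \<theta> s (E s x (q t \<xi>)) = increment \<theta> s (E s x \<xi>)"
      unfolding E_increment [OF \<theta> s x, symmetric] increment_before(2) [OF \<theta> s True] ..
    then show ?thesis
      by (simp add: increment_before(1) [OF \<theta> s True])
  next
    case False
    then have "q t (increment \<theta> s (E s x \<xi>)) = 0" "increment \<theta> s (q t (E s x \<xi>)) = 0"
      using t by (simp_all add: increment_after [OF \<theta> s])
    then show ?thesis
      using False x by (simp add: E_q)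
  qed
  then show "partition_exp \<theta> x (q t \<xi>) = q t (partition_exp \<theta> x \<xi>)"
    by (simp add: partition_exp_apply blinfun.sum_right)
  have "q t o\<^sub>L (increment \<theta> s o\<^sub>L E s x) \<in> F t" if s: "s \<in> \<theta> - {0}" for s
  proof (cases "s \<le> t")
    case True
    then have "q t o\<^sub>L (increment \<theta> s o\<^sub>L E s x) = increment \<theta> s o\<^sub>L E s x"
      by (intro blinfun_eqI) (simp add: increment_before [OF \<theta> s])
    moreover have "increment \<theta> s o\<^sub>L E s x \<in> F s"
      by (intro vna_compose [OF F_vna] increment_mem \<theta> s E_mem B_D x)
    ultimately show ?thesis
      using F_mono [OF True] by auto
  next
    case False
    then have "q t o\<^sub>L (increment \<theta> s o\<^sub>L E s x) = 0"
      using t by (intro blinfun_eqI) (simp add: increment_after [OF \<theta> s])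
    then show ?thesis
      by (simp add: vna_zero [OF F_vna])
  qed
  then have "(\<Sum>s\<in>\<theta> - {0}. q t o\<^sub>L (increment \<theta> s o\<^sub>L E s x)) \<in> F t"
    by (rule vna_sum [OF F_vna])
  moreover have "q t o\<^sub>L partition_exp \<theta> x = (\<Sum>s\<in>\<theta> - {0}. q t o\<^sub>L (increment \<theta> s o\<^sub>L E s x))"
    by (rule blinfun_eqI) (simp add: partition_exp_apply blinfun.sum_left blinfun.sum_right)
  ultimately show "q t o\<^sub>L partition_exp \<theta> x \<in> F t"
    by simp
qed

text \<open>An element of \<open>A_tau\<close> need not lie in \<open>F t\<close>, but its product
  with the increment at \<open>t\<close> does. Idempotence and commutation place a copy of the
  increment next to both \<open>b\<close> and \<open>c\<close>, and the bimodule property of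
  \<open>E t\<close> then applies termwise.\<close>

lemma partition_exp_bimodule:
  assumes \<theta>: "\<theta> \<in> time_partitions" and x: "x \<in> B" and b: "b \<in> A\<^sub>\<tau>" and c: "c \<in> A\<^sub>\<tau>"
  shows "partition_exp \<theta> (b o\<^sub>L x o\<^sub>L c) \<xi> = b (partition_exp \<theta> x (c \<xi>))"
proof -
  have "increment \<theta> t (E t (b o\<^sub>L x o\<^sub>L c) \<xi>) = b (increment \<theta> t (E t x (c \<xi>)))" if t: "t \<in> \<theta> - {0}" for t
  proof -
    let ?d = "increment \<theta> t"
    note idem = projection_op_idem [OF increment_projection [OF \<theta> t]]
    have mem: "?d o\<^sub>L a \<in> F t" if a: "a \<in> A\<^sub>\<tau>" for a
    proof -
      let ?p = "Max {s \<in> \<theta>. s < t}"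
      have p: "q ?p o\<^sub>L a \<in> F t"
        using A_tau_q_mem [OF a] F_mono [OF less_imp_le [OF previous_point(1) [OF \<theta> t]]] by blast
      have "(q t o\<^sub>L a) - (q ?p o\<^sub>L a) \<in> F t"
        by (rule vna_diff [OF F_vna A_tau_q_mem [OF a] p])
      moreover have "?d o\<^sub>L a = (q t o\<^sub>L a) - (q ?p o\<^sub>L a)"
        by (rule blinfun_eqI) (simp add: increment_def blinfun.diff_left)
      ultimately show ?thesis
        by simp
    qed
    note comm = B_increment [OF x] B_increment [OF A_tau_subset_B [OF b]] B_increment [OF A_tau_subset_B [OF c]]
    have "b o\<^sub>L x o\<^sub>L c \<in> A"
      by (intro vna_compose [OF A] B_D(1) x A_tau_subset_B [OF b] A_tau_subset_B [OF c])
    then have "?d o\<^sub>L E t (b o\<^sub>L x o\<^sub>L c) = E t (?d o\<^sub>L (b o\<^sub>L x o\<^sub>L c))"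
      by (simp add: E_left increment_mem [OF \<theta> t])
    also have "?d o\<^sub>L (b o\<^sub>L x o\<^sub>L c) = (?d o\<^sub>L b) o\<^sub>L x o\<^sub>L (?d o\<^sub>L c)"
      by (rule blinfun_eqI) (simp add: comm idem)
    also have "E t \<dots> = (?d o\<^sub>L b) o\<^sub>L E t x o\<^sub>L (?d o\<^sub>L c)"
      by (intro E_bimodule B_D(1) x mem b c)
    finally have "?d (E t (b o\<^sub>L x o\<^sub>L c) \<xi>) = ?d (b (E t x (?d (c \<xi>))))"
      by (metis blinfun_apply_blinfun_compose)
    then show ?thesis
      by (simp add: E_increment [OF \<theta> t x] comm idem)
  qed
  then show ?thesis
    by (simp add: partition_exp_apply blinfun.sum_right)
qed

lemma partition_exp_fixes:
  assumes "\<theta> \<in> time_partitions" "b \<in> A\<^sub>\<tau>"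
  shows "partition_exp \<theta> b = b"
proof (rule blinfun_eqI)
  fix \<xi>
  have "partition_exp \<theta> (b o\<^sub>L id_blinfun o\<^sub>L id_blinfun) \<xi> = b (partition_exp \<theta> id_blinfun (id_blinfun \<xi>))"
    by (rule partition_exp_bimodule [OF assms(1) vna_id [OF B_vna] assms(2) vna_id [OF A_tau_vna]])
  then show "partition_exp \<theta> b \<xi> = b \<xi>"
    by (simp add: partition_exp_id [OF assms(1)])
qed

text \<open>Each increment belongs to \<open>F t\<close>, so invariance under \<open>E t\<close>
  permits replacing \<open>E t x\<close> by \<open>x\<close> in every term; the resulting constant
  sum telescopes to \<open>x\<close>.\<close>

lemma partition_exp_state:
  assumes \<theta>: "\<theta> \<in> time_partitions" and x: "x \<in> A"
  shows "cinner (partition_exp \<theta> x \<Omega>) \<Omega> = cinner (x \<Omega>) \<Omega>"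
proof -
  have "cinner (increment \<theta> t (E t x \<Omega>)) \<Omega> = cinner (increment \<theta> t (x \<Omega>)) \<Omega>" if t: "t \<in> \<theta> - {0}" for t
  proof -
    note d = increment_mem [OF \<theta> t]
    have "increment \<theta> t o\<^sub>L x \<in> A"
      by (intro vna_compose [OF A] F_subset [OF d] x)
    from state [OF this, of t] show ?thesis
      by (simp add: vector_state_def E_left [OF x d])
  qed
  then have "cinner (partition_exp \<theta> x \<Omega>) \<Omega> = cinner (partition_sum q (\<lambda>_. x) \<theta> \<Omega>) \<Omega>"
    by (simp add: partition_exp_apply partition_sum_def blinfun.sum_left cinner.sum_left increment_def)
  then show ?thesis
    using \<theta> by (simp add: partition_sum_const q_0 q_infinity del: infinity_ennreal_def)
qed

section \<open>Passage to the limit along the partitions\<close>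

lemma eventually_time_partition: "eventually (\<lambda>\<theta>. \<theta> \<in> time_partitions) partitions_at_top"
  using eventually_partition [of 0] by eventually_elim simp

lemma commutant_dense: "closure ((\<lambda>a. blinfun_apply a \<Omega>) ` commutant A) = UNIV"
  by (rule separating_imp_commutant_cyclic [OF A separating])

lemma commutant_commutes: "a \<in> commutant A \<Longrightarrow> x \<in> A \<Longrightarrow> x (a \<xi>) = a (x \<xi>)"
  by (simp add: commutant_iff)

lemma eq_of_orbit_eq: "x \<in> A \<Longrightarrow> y \<in> A \<Longrightarrow> x \<Omega> = y \<Omega> \<Longrightarrow> x = y"
  using separating vna_diff [OF A, of x y]
  by (auto simp: separating_vector_def blinfun.diff_left)

lemma partition_exp_converges:
  assumes x: "x \<in> B"
  shows "\<exists>y\<in>A. \<forall>\<xi>. ((\<lambda>\<theta>. partition_exp \<theta> x \<xi>) \<longlongrightarrow> y \<xi>) partitions_at_top"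
proof -
  note xA = B_D(1) [OF x]
  have "\<exists>y\<in>bounded_ops. \<forall>\<xi>. ((\<lambda>\<theta>. partition_exp \<theta> x \<xi>) \<longlongrightarrow> y \<xi>) partitions_at_top"
  proof (rule bounded_net_strong_limit [OF partitions_not_bot _ _ commutant_dense])
    show "eventually (\<lambda>\<theta>. norm (partition_exp \<theta> x) \<le> 6 * norm x) partitions_at_top"
      using eventually_time_partition by eventually_elim (rule partition_exp_norm [OF _ x])
    show "eventually (\<lambda>\<theta>. partition_exp \<theta> x \<in> bounded_ops) partitions_at_top"
      using eventually_time_partition by eventually_elim (rule vna_bounded [OF A partition_exp_mem [OF _ xA]])
    fix d assume "d \<in> (\<lambda>a. blinfun_apply a \<Omega>) ` commutant A"
    then obtain a where a: "a \<in> commutant A" "d = a \<Omega>"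
      by blast
    have "((\<lambda>\<theta>. a (M \<theta> (x \<Omega>))) \<longlongrightarrow> a (time_projection F \<Omega> q (x \<Omega>))) partitions_at_top"
      by (rule bounded_linear.tendsto [OF blinfun.bounded_linear_right M_limit(2)])
    moreover have "eventually (\<lambda>\<theta>. a (M \<theta> (x \<Omega>)) = partition_exp \<theta> x d) partitions_at_top"
      using eventually_time_partition
      by eventually_elim (simp add: a commutant_commutes partition_exp_mem xA partition_exp_orbit)
    ultimately show "\<exists>l. ((\<lambda>\<theta>. partition_exp \<theta> x d) \<longlongrightarrow> l) partitions_at_top"
      by (intro exI) (rule Lim_transform_eventually)
  qed
  then obtain y where y: "y \<in> bounded_ops"
      "\<And>\<xi>. ((\<lambda>\<theta>. partition_exp \<theta> x \<xi>) \<longlongrightarrow> y \<xi>) partitions_at_top"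
    by auto
  have "y \<in> A"
  proof (rule vna_strong_limit [OF A partitions_not_bot _ y])
    show "eventually (\<lambda>\<theta>. partition_exp \<theta> x \<in> A) partitions_at_top"
      using eventually_time_partition by eventually_elim (rule partition_exp_mem [OF _ xA])
  qed
  with y(2) show ?thesis
    by blast
qed

text \<open>For \<open>x\<close> in \<open>B\<close> the chosen operator is the strong limit, which
  is unique; elsewhere its value is unspecified.\<close>

definition stopped_exp :: "'h \<Rightarrow>\<^sub>L 'h \<Rightarrow> 'h \<Rightarrow>\<^sub>L 'h" where
  "stopped_exp x = (SOME y. y \<in> A \<and> (\<forall>\<xi>. ((\<lambda>\<theta>. partition_exp \<theta> x \<xi>) \<longlongrightarrow> y \<xi>) partitions_at_top))"

lemma stopped_exp:
  assumes "x \<in> B"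
  shows stopped_exp_mem: "stopped_exp x \<in> A"
    and stopped_exp_limit: "((\<lambda>\<theta>. partition_exp \<theta> x \<xi>) \<longlongrightarrow> stopped_exp x \<xi>) partitions_at_top"
proof -
  have "\<exists>y. y \<in> A \<and> (\<forall>\<xi>. ((\<lambda>\<theta>. partition_exp \<theta> x \<xi>) \<longlongrightarrow> y \<xi>) partitions_at_top)"
    using partition_exp_converges [OF assms] by blast
  from someI_ex [OF this]
  show "stopped_exp x \<in> A" "((\<lambda>\<theta>. partition_exp \<theta> x \<xi>) \<longlongrightarrow> stopped_exp x \<xi>) partitions_at_top"
    by (simp_all add: stopped_exp_def)
qed

text \<open>Elements of \<open>A\<close> are determined by their value at the separating vector, so
  it suffices to identify the limit at \<open>\<Omega>\<close>.\<close>

lemma stopped_exp_eqI: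
  assumes x: "x \<in> B" and "y \<in> A"
    and y: "((\<lambda>\<theta>. partition_exp \<theta> x \<Omega>) \<longlongrightarrow> y \<Omega>) partitions_at_top"
  shows "stopped_exp x = y"
proof (rule eq_of_orbit_eq [OF stopped_exp_mem [OF x] \<open>y \<in> A\<close>])
  show "stopped_exp x \<Omega> = y \<Omega>"
    by (rule tendsto_unique [OF partitions_not_bot stopped_exp_limit [OF x] y])
qed

lemma stopped_exp_orbit:
  assumes x: "x \<in> B"
  shows "stopped_exp x \<Omega> = time_projection F \<Omega> q (x \<Omega>)"
proof (rule tendsto_unique [OF partitions_not_bot stopped_exp_limit [OF x]])
  show "((\<lambda>\<theta>. partition_exp \<theta> x \<Omega>) \<longlongrightarrow> time_projection F \<Omega> q (x \<Omega>)) partitions_at_top"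
    by (simp add: partition_exp_orbit [OF B_D(1) [OF x]] M_limit)
qed

lemma stopped_exp_mem_A_tau:
  assumes x: "x \<in> B"
  shows "stopped_exp x \<in> A\<^sub>\<tau>"
proof -
  note y = vna_bounded [OF A stopped_exp_mem [OF x]]
  have "a o\<^sub>L stopped_exp x = stopped_exp x o\<^sub>L a" if "a \<in> A_tau_relations" for a
  proof -
    consider "a \<in> commutant A" | t b where "t < \<infinity>" "b \<in> commutant (F t)" "a = q t o\<^sub>L b"
      using \<open>a \<in> A_tau_relations\<close> unfolding A_tau_relations_def by blast
    then show ?thesis
    proof cases
      case 1
      then show ?thesis
        using stopped_exp_mem [OF x] by (simp add: commutant_def)
    next
      case 2
      \<comment> \<open>The relations are treated singly: the partitions that guarantee this one are
        those containing \<open>t\<close>, and no finite partition contains every time.\<close>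
      have "stopped_exp x \<in> commutant {a}"
      proof (rule commutant_strong_limit [OF partitions_not_bot _ y stopped_exp_limit [OF x]])
        show "eventually (\<lambda>\<theta>. partition_exp \<theta> x \<in> commutant {a}) partitions_at_top"
          using eventually_partition [of t]
        proof eventually_elim
          case (elim \<theta>)
          have bd: "partition_exp \<theta> x \<in> bounded_ops"
            using elim by (intro vna_bounded [OF A] partition_exp_mem B_D(1) x) simp
          have "partition_exp \<theta> x o\<^sub>L q t = q t o\<^sub>L partition_exp \<theta> x" "q t o\<^sub>L partition_exp \<theta> x \<in> F t"
            using partition_exp_q [OF _ _ x] elim by (auto intro!: blinfun_eqI)
          then have "partition_exp \<theta> x o\<^sub>L a = a o\<^sub>L partition_exp \<theta> x"
            using q_comp_mem_iff [OF bd] 2 by blast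
          then show ?case
            using bd by (simp add: commutant_def)
        qed
      qed
      then show ?thesis
        by (simp add: commutant_def)
    qed
  qed
  then show ?thesis
    unfolding A_tau_eq using y by (simp add: commutant_def)
qed

lemma stopped_exp_fixes: "b \<in> A\<^sub>\<tau> \<Longrightarrow> stopped_exp b = b"
proof (rule stopped_exp_eqI)
  assume b: "b \<in> A\<^sub>\<tau>"
  then show "b \<in> B"
    by (rule A_tau_subset_B)
  then show "b \<in> A"
    by (rule B_D)
  have "eventually (\<lambda>\<theta>. b \<Omega> = partition_exp \<theta> b \<Omega>) partitions_at_top"
    using eventually_time_partition by eventually_elim (simp add: partition_exp_fixes b)
  then show "((\<lambda>\<theta>. partition_exp \<theta> b \<Omega>) \<longlongrightarrow> b \<Omega>) partitions_at_top"
    by (rule Lim_transform_eventually [OF tendsto_const])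
qed

text \<open>Linearity is read off at \<open>\<Omega>\<close>, where the map is given by the linear
  operator \<open>time_projection F \<Omega> q\<close>.\<close>

lemma stopped_exp_add: "x \<in> B \<Longrightarrow> y \<in> B \<Longrightarrow> stopped_exp (x + y) = stopped_exp x + stopped_exp y"
  by (rule eq_of_orbit_eq)
    (simp_all add: stopped_exp_mem vna_add [OF A] vna_add [OF B_vna] blinfun.add_left blinfun.add_right
      stopped_exp_orbit)

lemma stopped_exp_scaleC: "x \<in> B \<Longrightarrow> stopped_exp (c *\<^sub>C x) = c *\<^sub>C stopped_exp x"
  by (rule eq_of_orbit_eq)
    (simp_all add: stopped_exp_mem vna_scaleC [OF A] vna_scaleC [OF B_vna] scaleC_blinfun.rep_eq
      stopped_exp_orbit bounded_opsD [OF M_limit(1)])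

lemma stopped_exp_diff: "x \<in> B \<Longrightarrow> y \<in> B \<Longrightarrow> stopped_exp (x - y) = stopped_exp x - stopped_exp y"
  by (rule eq_of_orbit_eq)
    (simp_all add: stopped_exp_mem vna_diff [OF A] vna_diff [OF B_vna] blinfun.diff_left blinfun.diff_right
      stopped_exp_orbit)

lemma stopped_exp_positive:
  assumes x: "x \<in> B" "positive_op x"
  shows "positive_op (stopped_exp x)"
  unfolding positive_op_def
proof (intro conjI allI vna_bounded [OF A stopped_exp_mem [OF x(1)]])
  fix \<xi>
  have lim: "((\<lambda>\<theta>. cinner (partition_exp \<theta> x \<xi>) \<xi>) \<longlongrightarrow> cinner (stopped_exp x \<xi>) \<xi>) partitions_at_top"
    by (intro cinner.tendsto stopped_exp_limit x tendsto_const)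
  show "cinner (stopped_exp x \<xi>) \<xi> \<in> \<real>\<^sub>\<ge>\<^sub>0"
  proof (rule Lim_in_closed_set [OF closed_nonneg_Reals_complex _ partitions_not_bot lim])
    show "eventually (\<lambda>\<theta>. cinner (partition_exp \<theta> x \<xi>) \<xi> \<in> \<real>\<^sub>\<ge>\<^sub>0) partitions_at_top"
      using eventually_time_partition
      by eventually_elim (use partition_exp_positive [OF _ x] in \<open>simp add: positive_op_def\<close>)
  qed
qed

lemma stopped_exp_bimodule:
  assumes x: "x \<in> B" and b: "b \<in> A\<^sub>\<tau>" and c: "c \<in> A\<^sub>\<tau>"
  shows "stopped_exp (b o\<^sub>L x o\<^sub>L c) = b o\<^sub>L stopped_exp x o\<^sub>L c"
proof (rule stopped_exp_eqI)
  note bB = A_tau_subset_B [OF b] and cB = A_tau_subset_B [OF c]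
  show "b o\<^sub>L x o\<^sub>L c \<in> B"
    by (intro vna_compose [OF B_vna] x bB cB)
  show "b o\<^sub>L stopped_exp x o\<^sub>L c \<in> A"
    by (intro vna_compose [OF A] stopped_exp_mem x B_D(1) [OF bB] B_D(1) [OF cB])
  have "((\<lambda>\<theta>. b (partition_exp \<theta> x (c \<Omega>))) \<longlongrightarrow> b (stopped_exp x (c \<Omega>))) partitions_at_top"
    by (rule bounded_linear.tendsto [OF blinfun.bounded_linear_right stopped_exp_limit [OF x]])
  moreover have "eventually (\<lambda>\<theta>. b (partition_exp \<theta> x (c \<Omega>)) = partition_exp \<theta> (b o\<^sub>L x o\<^sub>L c) \<Omega>) partitions_at_top"
    using eventually_time_partition by eventually_elim (simp add: partition_exp_bimodule x b c)
  ultimately show "((\<lambda>\<theta>. partition_exp \<theta> (b o\<^sub>L x o\<^sub>L c) \<Omega>) \<longlongrightarrow> (b o\<^sub>L stopped_exp x o\<^sub>L c) \<Omega>) partitions_at_top"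
    by (simp add: Lim_transform_eventually)
qed

lemma stopped_exp_state:
  assumes x: "x \<in> B"
  shows "vector_state \<Omega> (stopped_exp x) = vector_state \<Omega> x"
  unfolding vector_state_def
proof (rule tendsto_unique [OF partitions_not_bot])
  show "((\<lambda>\<theta>. cinner (partition_exp \<theta> x \<Omega>) \<Omega>) \<longlongrightarrow> cinner (stopped_exp x \<Omega>) \<Omega>) partitions_at_top"
    by (intro cinner.tendsto stopped_exp_limit x tendsto_const)
  have "eventually (\<lambda>\<theta>. cinner (x \<Omega>) \<Omega> = cinner (partition_exp \<theta> x \<Omega>) \<Omega>) partitions_at_top"
    using eventually_time_partition by eventually_elim (simp add: partition_exp_state B_D(1) [OF x])
  then show "((\<lambda>\<theta>. cinner (partition_exp \<theta> x \<Omega>) \<Omega>) \<longlongrightarrow> cinner (x \<Omega>) \<Omega>) partitions_at_top"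
    by (rule Lim_transform_eventually [OF tendsto_const])
qed

section \<open>Conditional expectation, faithfulness and normality\<close>

lemma stopped_exp_conditional_expectation: "conditional_expectation B A\<^sub>\<tau> stopped_exp"
  unfolding conditional_expectation_def
proof (intro conjI ballI allI impI)
  show "stopped_exp ` B = A\<^sub>\<tau>"
  proof (intro equalityI subsetI)
    show "y \<in> A\<^sub>\<tau>" if "y \<in> stopped_exp ` B" for y
      using that stopped_exp_mem_A_tau by blast
    show "b \<in> stopped_exp ` B" if "b \<in> A\<^sub>\<tau>" for b
      by (rule image_eqI [OF _ A_tau_subset_B [OF that]]) (simp add: stopped_exp_fixes that)
  qed
qed (auto simp: B_vna A_tau_vna A_tau_subset_B stopped_exp_add stopped_exp_scaleC stopped_exp_positive
    stopped_exp_fixes stopped_exp_bimodule)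

text \<open>Invariance of the state turns the hypothesis into vanishing of the squared norm of
  \<open>x \<Omega>\<close>, and \<open>\<Omega>\<close> is separating.\<close>

lemma stopped_exp_faithful: "faithful_map B stopped_exp"
  unfolding faithful_map_def
proof (intro ballI impI)
  fix x assume x: "x \<in> B" and 0: "stopped_exp (adjoint_op x o\<^sub>L x) = 0"
  have "adjoint_op x o\<^sub>L x \<in> B"
    by (intro vna_compose [OF B_vna] vna_adjoint [OF B_vna] x)
  then have "cinner ((adjoint_op x o\<^sub>L x) \<Omega>) \<Omega> = 0"
    using stopped_exp_state [of "adjoint_op x o\<^sub>L x"] 0 by (simp add: vector_state_def)
  then have "x \<Omega> = 0"
    using norm_cinner_self [of "x \<Omega>"] by (simp add: cinner_adjoint' vna_bounded [OF B_vna x])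
  then show "x = 0"
    using separating B_D(1) [OF x] by (auto simp: separating_vector_def)
qed

lemma stopped_exp_selfadjoint: "x \<in> B \<Longrightarrow> selfadjoint_op x \<Longrightarrow> selfadjoint_op (stopped_exp x)"
  by (rule positive_unital_selfadjoint [OF B_vna])
    (auto simp: stopped_exp_add stopped_exp_scaleC stopped_exp_positive stopped_exp_fixes vna_id [OF A_tau_vna])

text \<open>That the image of \<open>s\<close> is an upper bound is positivity. For leastness, the
  forms of the images are compared with that of an upper bound \<open>u\<close> on the dense orbit
  of the commutant.\<close>

lemma stopped_exp_normal: "normal_map B A\<^sub>\<tau> stopped_exp"
  unfolding normal_map_def
proof (intro allI impI)
  fix D s
  assume "D \<subseteq> B \<and> D \<noteq> {} \<and> (\<forall>d\<in>D. selfadjoint_op d) \<and>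
    (\<forall>d\<in>D. \<forall>e\<in>D. \<exists>f\<in>D. op_le d f \<and> op_le e f) \<and> is_op_sup B D s"
  then have D: "D \<subseteq> B" "D \<noteq> {}" "\<forall>d\<in>D. selfadjoint_op d"
      "\<forall>d\<in>D. \<forall>e\<in>D. \<exists>f\<in>D. op_le d f \<and> op_le e f" "is_op_sup B D s"
    by auto
  have s: "s \<in> B" "selfadjoint_op s" "\<And>d. d \<in> D \<Longrightarrow> op_le d s"
    using D(5) by (auto simp: is_op_sup_def)
  note lim = op_sup_strong_limit [OF B_vna D]
  show "is_op_sup A\<^sub>\<tau> (stopped_exp ` D) (stopped_exp s)"
    unfolding is_op_sup_def
  proof (intro conjI ballI impI)
    show "stopped_exp s \<in> A\<^sub>\<tau>" "selfadjoint_op (stopped_exp s)"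
      using s by (simp_all add: stopped_exp_mem_A_tau stopped_exp_selfadjoint)
    show "op_le e (stopped_exp s)" if "e \<in> stopped_exp ` D" for e
    proof -
      obtain d where d: "d \<in> D" "e = stopped_exp d"
        using \<open>e \<in> stopped_exp ` D\<close> by blast
      then have "stopped_exp (s - d) = stopped_exp s - e"
        using D s by (auto simp: stopped_exp_diff)
      moreover have "positive_op (stopped_exp (s - d))"
        using s d D by (intro stopped_exp_positive vna_diff [OF B_vna]) (auto simp: op_le_def)
      ultimately show ?thesis
        by (simp add: op_le_def)
    qed
    fix u assume u: "u \<in> A\<^sub>\<tau>" "selfadjoint_op u \<and> (\<forall>d\<in>stopped_exp ` D. op_le d u)"
    let ?S = "{\<xi>. Re (cinner (stopped_exp s \<xi>) \<xi>) \<le> Re (cinner (u \<xi>) \<xi>)}"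
    have "(\<lambda>a. blinfun_apply a \<Omega>) ` commutant A \<subseteq> ?S"
    proof clarify
      fix a assume a: "a \<in> commutant A"
      let ?\<xi> = "a \<Omega>"
      \<comment> \<open>At \<open>a \<Omega>\<close> the image of \<open>x\<close> depends
        continuously on the vector \<open>x \<Omega>\<close> alone, so strong convergence of
        \<open>D\<close> to \<open>s\<close> carries over to the images on these vectors.\<close>
      have orbit: "stopped_exp x ?\<xi> = a (time_projection F \<Omega> q (x \<Omega>))" if "x \<in> B" for x
        using that by (simp add: commutant_commutes [OF a] stopped_exp_mem stopped_exp_orbit)
      have "((\<lambda>d. Re (cinner (a (time_projection F \<Omega> q (blinfun_apply d \<Omega>))) ?\<xi>)) \<longlongrightarrow>
          Re (cinner (a (time_projection F \<Omega> q (s \<Omega>))) ?\<xi>)) (net_at_top D op_le)"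
        by (intro tendsto_Re cinner.tendsto bounded_linear.tendsto [OF blinfun.bounded_linear_right] lim(2) tendsto_const)
      moreover have "eventually (\<lambda>d. Re (cinner (a (time_projection F \<Omega> q (blinfun_apply d \<Omega>))) ?\<xi>) \<le> Re (cinner (u ?\<xi>) ?\<xi>))
          (net_at_top D op_le)"
      proof -
        obtain d0 where "d0 \<in> D"
          using D by blast
        then show ?thesis
        proof (rule eventually_net_at_topI [OF lim(1)])
          fix d assume d: "d \<in> D"
          then have "op_le (stopped_exp d) u" "selfadjoint_op (stopped_exp d)" "d \<in> B"
            using u D stopped_exp_selfadjoint by auto
          then show "Re (cinner (a (time_projection F \<Omega> q (blinfun_apply d \<Omega>))) ?\<xi>) \<le> Re (cinner (u ?\<xi>) ?\<xi>)"
            using u by (simp add: op_le_iff flip: orbit)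
        qed
      qed
      ultimately have "Re (cinner (a (time_projection F \<Omega> q (s \<Omega>))) ?\<xi>) \<le> Re (cinner (u ?\<xi>) ?\<xi>)"
        by (rule tendsto_upperbound [OF _ _ net_at_top_not_bot [OF lim(1)]])
      then show "Re (cinner (stopped_exp s ?\<xi>) ?\<xi>) \<le> Re (cinner (u ?\<xi>) ?\<xi>)"
        by (simp add: orbit s)
    qed
    moreover have "closed ?S"
      by (intro closed_Collect_le continuous_on_Re cinner.continuous_on
          linear_continuous_on blinfun.bounded_linear_right continuous_on_id)
    ultimately have "closure ((\<lambda>a. blinfun_apply a \<Omega>) ` commutant A) \<subseteq> ?S"
      by (rule closure_minimal)
    then have "Re (cinner (stopped_exp s \<xi>) \<xi>) \<le> Re (cinner (u \<xi>) \<xi>)" for \<xi>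
      unfolding commutant_dense by blast
    then show "op_le (stopped_exp s) u"
      using u s by (simp add: op_le_iff stopped_exp_selfadjoint)
  qed
qed

end

theorem theorem3:
  fixes A :: "('h::complex_hilbert \<Rightarrow>\<^sub>L 'h) set"
    and \<Omega> :: 'h
    and F :: "ennreal \<Rightarrow> ('h \<Rightarrow>\<^sub>L 'h) set"
    and E :: "ennreal \<Rightarrow> 'h \<Rightarrow>\<^sub>L 'h \<Rightarrow> 'h \<Rightarrow>\<^sub>L 'h"
    and q :: "ennreal \<Rightarrow> 'h \<Rightarrow>\<^sub>L 'h"
  assumes "von_neumann_algebra A"
    and "norm \<Omega> = 1" and "cyclic_vector A \<Omega>" and "separating_vector A \<Omega>"
    and "filtration A F"
    and "\<And>t. t < \<infinity> \<Longrightarrow> conditional_expectation A (F t) (E t)"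
    and "\<And>t. t < \<infinity> \<Longrightarrow> normal_map A (F t) (E t)"
    and "\<And>t x. t < \<infinity> \<Longrightarrow> x \<in> A \<Longrightarrow> vector_state \<Omega> (E t x) = vector_state \<Omega> x"
    and "stopping_time F q"
  shows "(\<forall>x \<in> B_tau A q. \<exists>!y.
        y \<in> A \<and> blinfun_apply y \<Omega> = time_projection F \<Omega> q (blinfun_apply x \<Omega>)) \<and>
    (\<exists>E\<^sub>\<tau>.
      (\<forall>x \<in> B_tau A q. E\<^sub>\<tau> x \<in> A \<and>
          blinfun_apply (E\<^sub>\<tau> x) \<Omega> = time_projection F \<Omega> q (blinfun_apply x \<Omega>)) \<and>
      conditional_expectation (B_tau A q) (A_tau A F q) E\<^sub>\<tau> \<and>
      normal_map (B_tau A q) (A_tau A F q) E\<^sub>\<tau> \<and>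
      faithful_map (B_tau A q) E\<^sub>\<tau> \<and>
      (\<forall>x \<in> B_tau A q. vector_state \<Omega> (E\<^sub>\<tau> x) = vector_state \<Omega> x))"
proof -
  have F: "F \<infinity> = A" "\<And>t. t < \<infinity> \<Longrightarrow> F t \<subseteq> A" "\<And>s t. s \<le> t \<Longrightarrow> t < \<infinity> \<Longrightarrow> F s \<subseteq> F t"
    using assms(5) unfolding filtration_def by blast+
  have fin: "t < \<infinity>" if "t \<noteq> \<infinity>" for t :: ennreal
    using that by (simp add: less_top)
  \<comment> \<open>At the final time the algebra is \<open>A\<close> itself, and its conditional
    expectation is the identity.\<close>
  define E' where "E' t = (if t < \<infinity> then E t else (\<lambda>x. x))" for t
  interpret stopped_filtration A \<Omega> F E' q
  proof
    show "F s \<subseteq> F t" if "s \<le> t" for s t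
    proof (cases "t = \<infinity>")
      case True
      then show ?thesis
        using F fin by (metis order_refl)
    qed (use F fin that in blast)
    show "conditional_expectation A (F t) (E' t)" for t
    proof (cases "t = \<infinity>")
      case True
      then show ?thesis
        using F(1) assms(1) by (simp add: E'_def conditional_expectation_def del: infinity_ennreal_def)
    qed (use assms(6) fin in \<open>simp add: E'_def del: infinity_ennreal_def\<close>)
    show "vector_state \<Omega> (E' t x) = vector_state \<Omega> x" if "x \<in> A" for t x
      using assms(8) that by (simp add: E'_def)
  qed (use assms F in auto)
  show ?thesis
  proof (intro conjI ballI exI [of _ stopped_exp])
    fix x assume x: "x \<in> B_tau A q"
    show "\<exists>!y. y \<in> A \<and> y \<Omega> = time_projection F \<Omega> q (x \<Omega>)"
    proof (rule ex1I)
      show "stopped_exp x \<in> A \<and> stopped_exp x \<Omega> = time_projection F \<Omega> q (x \<Omega>)"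
        using x by (simp add: stopped_exp_mem stopped_exp_orbit)
      show "y = stopped_exp x" if "y \<in> A \<and> y \<Omega> = time_projection F \<Omega> q (x \<Omega>)" for y
        using that x by (intro eq_of_orbit_eq) (simp_all add: stopped_exp_mem stopped_exp_orbit)
    qed
  qed (simp_all add: stopped_exp_mem stopped_exp_orbit stopped_exp_conditional_expectation
      stopped_exp_normal stopped_exp_faithful stopped_exp_state)
qed

end
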